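(* No odd theta graph whose base vertices are not adjacent is a complete intersection, and no even theta graph is a complete intersection.
   Context: Graphs are finite, simple (no loops, no multiple edges) and undirected. Let $k$ be an arbitrary field. For a graph $G$ with $V(G)=\{v_1,\ldots,v_m\}$ and $E(G)=\{e_1,\ldots,e_n\}$, the toric ideal $P_G$ of $G$ is the kernel of the $k$-algebra homomorphism $k[x_1,\ldots,x_n]\to k[t_1,\ldots,t_m]$ with $x_i\mapsto t_jt_l$ whenever $e_i=\{v_j,v_l\}$. $G$ is a complete intersection if $\mu(P_G)=\mathrm{ht}(P_G)$, where $\mu(P_G)$ is the minimal number of generators of $P_G$. A theta graph with base vertices $x,y$ is a graph $T$ with $V(T)=V(\mathcal{P}_1)\cup V(\mathcal{P}_2)\cup V(\mathcal{P}_3)$, where $\mathcal{P}_1,\mathcal{P}_2,\mathcal{P}_3$ are three paths in $T$ of length $\ge2$ connecting the distinct vertices $x$ and $y$ such that $V(\mathcal{P}_i)\cap V(\mathcal{P}_j)=\{x,y\}$ for $1\le i<j\le3$. $T$ may have further edges besides those of the three paths (joining vertices of different paths or two vertices of the same path). $T$ is an even (respectively odd) theta graph if $\mathcal{P}_1,\mathcal{P}_2,\mathcal{P}_3$ all have even (respectively odd) length. *)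

theory Defs
  imports
    "HOL-Algebra.RingHom"
    "HOL-Library.Poly_Mapping"
    "HOL-Library.Extended_Nat"
begin

section \<open>Polynomial rings in a set of variables\<close>

text \<open>A monomial is a finitely supported exponent function \<open>'x \<Rightarrow>\<^sub>0 nat\<close>, and a polynomial is
  a finitely supported function from monomials to coefficients, multiplied by convolution.\<close>

type_synonym ('x, 'k) mpoly = "('x \<Rightarrow>\<^sub>0 nat) \<Rightarrow>\<^sub>0 'k"

definition Var :: "'x \<Rightarrow> ('x, 'k::comm_ring_1) mpoly" where
  "Var x = Poly_Mapping.single (Poly_Mapping.single x 1) 1"

definition Const :: "'k::comm_ring_1 \<Rightarrow> ('x, 'k) mpoly" where
  "Const c = Poly_Mapping.single 0 c"

text \<open>The polynomial ring \<open>k[x | x \<in> A]\<close> in exactly the variables from \<open>A\<close>.\<close>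

definition polynomial_ring :: "'x set \<Rightarrow> ('x, 'k::comm_ring_1) mpoly ring" where
  "polynomial_ring A =
     \<lparr>carrier = {p. \<forall>m\<in>Poly_Mapping.keys p. Poly_Mapping.keys m \<subseteq> A},
      mult = (*), one = 1, zero = 0, add = (+)\<rparr>"

text \<open>The \<open>k\<close>-algebra homomorphism determined by \<open>x \<mapsto> f x\<close>.\<close>

definition subst :: "('x \<Rightarrow> ('y, 'k::comm_ring_1) mpoly) \<Rightarrow> ('x, 'k) mpoly \<Rightarrow> ('y, 'k) mpoly" where
  "subst f p =
     (\<Sum>m\<in>Poly_Mapping.keys p.
        Const (Poly_Mapping.lookup p m) *
        (\<Prod>x\<in>Poly_Mapping.keys m. f x ^ Poly_Mapping.lookup m x))"

lemma subst_Var: "subst f (Var x) = f x"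
  by (simp add: subst_def Var_def Const_def)

lemma cring_polynomial_ring: "cring (polynomial_ring A :: ('x, 'k::comm_ring_1) mpoly ring)"
proof (intro cringI abelian_groupI comm_monoidI)
  fix p q :: "('x, 'k) mpoly"
  assume p: "p \<in> carrier (polynomial_ring A)" and q: "q \<in> carrier (polynomial_ring A)"
  show "p \<oplus>\<^bsub>polynomial_ring A\<^esub> q \<in> carrier (polynomial_ring A)"
    using p q Poly_Mapping.keys_add[of p q] by (auto simp: polynomial_ring_def)
  show "p \<otimes>\<^bsub>polynomial_ring A\<^esub> q \<in> carrier (polynomial_ring A)"
  proof -
    have "Poly_Mapping.keys m \<subseteq> A" if m: "m \<in> Poly_Mapping.keys (p * q)" for m
    proof -
      from m keys_mult[of p q] obtain a b where "m = a + b"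
        "a \<in> Poly_Mapping.keys p" "b \<in> Poly_Mapping.keys q" by blast
      moreover from this p q have "Poly_Mapping.keys a \<subseteq> A" "Poly_Mapping.keys b \<subseteq> A"
        by (auto simp: polynomial_ring_def)
      ultimately show ?thesis
        using Poly_Mapping.keys_add[of a b] by blast
    qed
    then show ?thesis by (simp add: polynomial_ring_def)
  qed
  show "\<exists>r\<in>carrier (polynomial_ring A). r \<oplus>\<^bsub>polynomial_ring A\<^esub> p = \<zero>\<^bsub>polynomial_ring A\<^esub>"
    using p by (intro bexI[of _ "- p"]) (simp_all add: polynomial_ring_def)
qed (auto simp: polynomial_ring_def algebra_simps)

section \<open>Height and minimal number of generators\<close>

text \<open>The height of a prime ideal \<open>P\<close>: the supremum of the lengths \<open>n\<close> of strictly increasing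
  chains \<open>Q 0 \<subset> \<dots> \<subset> Q n = P\<close> of prime ideals.  It is only meaningful for prime \<open>P\<close>.\<close>

definition height :: "('a, 'b) ring_scheme \<Rightarrow> 'a set \<Rightarrow> enat" where
  "height R P =
     Sup {enat n | n. \<exists>Q :: nat \<Rightarrow> 'a set.
            (\<forall>i\<le>n. primeideal (Q i) R) \<and> (\<forall>i<n. Q i \<subset> Q (Suc i)) \<and> Q n = P}"

definition min_generators :: "('a, 'b) ring_scheme \<Rightarrow> 'a set \<Rightarrow> enat" where
  "min_generators R I =
     Inf {enat (card S) | S. finite S \<and> S \<subseteq> carrier R \<and> genideal R S = I}"

section \<open>Graphs and their toric ideals\<close>

definition simple_graph :: "'v set \<Rightarrow> 'v set set \<Rightarrow> bool" where
  "simple_graph V E \<longleftrightarrow> finite V \<and> (\<forall>e\<in>E. e \<subseteq> V \<and> card e = 2)"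

text \<open>The variables of the source ring are the edges themselves, those of the target ring the
  vertices; an edge \<open>{v, w}\<close> is sent to \<open>t\<^sub>v t\<^sub>w\<close>.\<close>

definition edge_monomial :: "'v set \<Rightarrow> ('v, 'k::field) mpoly" where
  "edge_monomial e = (\<Prod>v\<in>e. Var v)"

definition toric_ideal :: "'v set \<Rightarrow> 'v set set \<Rightarrow> ('v set, 'k::field) mpoly set" where
  "toric_ideal V E = a_kernel (polynomial_ring E) (polynomial_ring V) (subst edge_monomial)"

definition complete_intersection :: "'k::field itself \<Rightarrow> 'v set \<Rightarrow> 'v set set \<Rightarrow> bool" where
  "complete_intersection _ V E \<longleftrightarrow>
     (let R = polynomial_ring E :: ('v set, 'k) mpoly ring; P = toric_ideal V E
      in min_generators R P = height R P)"

section \<open>Theta graphs\<close>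

text \<open>A path is given by the list of its successive vertices.\<close>

definition path_between :: "'v set \<Rightarrow> 'v set set \<Rightarrow> 'v \<Rightarrow> 'v \<Rightarrow> 'v list \<Rightarrow> bool" where
  "path_between V E x y p \<longleftrightarrow>
     p \<noteq> [] \<and> hd p = x \<and> last p = y \<and> distinct p \<and> set p \<subseteq> V \<and>
     (\<forall>i. Suc i < length p \<longrightarrow> {p ! i, p ! Suc i} \<in> E)"

definition path_length :: "'v list \<Rightarrow> nat" where
  "path_length p = length p - 1"

text \<open>Edges of the graph outside the three paths are allowed.\<close>

definition theta_paths ::
    "'v set \<Rightarrow> 'v set set \<Rightarrow> 'v \<Rightarrow> 'v \<Rightarrow> 'v list \<Rightarrow> 'v list \<Rightarrow> 'v list \<Rightarrow> bool" where
  "theta_paths V E x y p1 p2 p3 \<longleftrightarrow>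
     simple_graph V E \<and> x \<noteq> y \<and>
     (\<forall>p\<in>{p1, p2, p3}. path_between V E x y p \<and> path_length p \<ge> 2) \<and>
     set p1 \<inter> set p2 = {x, y} \<and> set p1 \<inter> set p3 = {x, y} \<and> set p2 \<inter> set p3 = {x, y} \<and>
     V = set p1 \<union> set p2 \<union> set p3"

definition even_theta_graph :: "'v set \<Rightarrow> 'v set set \<Rightarrow> 'v \<Rightarrow> 'v \<Rightarrow> bool" where
  "even_theta_graph V E x y \<longleftrightarrow>
     (\<exists>p1 p2 p3. theta_paths V E x y p1 p2 p3 \<and>
        even (path_length p1) \<and> even (path_length p2) \<and> even (path_length p3))"

definition odd_theta_graph :: "'v set \<Rightarrow> 'v set set \<Rightarrow> 'v \<Rightarrow> 'v \<Rightarrow> bool" where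
  "odd_theta_graph V E x y \<longleftrightarrow>
     (\<exists>p1 p2 p3. theta_paths V E x y p1 p2 p3 \<and>
        odd (path_length p1) \<and> odd (path_length p2) \<and> odd (path_length p3))"

end

theory Submission
  imports Defs Complex_Main "HOL-Library.Function_Algebras"
begin

text \<open>
  Let \<open>n\<close> be the number of edges, and call a real vector on the edges a relation if it lies in the kernel
  of the vertex-edge incidence matrix; the exponent difference of two monomials with the same image
  under \<open>x\<^sub>e \<mapsto> t\<^sub>v t\<^sub>w\<close> is one.  If the toric ideal \<open>P\<close> is a complete intersection, then the relations
  have a basis \<open>B\<close> that is compatible with supports: whenever two monomials have the same image and
  that image involves only variables from a vertex set \<open>W\<close>, their exponent difference is a combination of
  those members of \<open>B\<close> that live on edges inside \<open>W\<close> (\<open>relation_basis\<close>).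

  The theorem follows from this.  Let \<open>a\<^sub>i\<close> and \<open>b\<^sub>i\<close> be the products of the edges of the path \<open>P\<^sub>i\<close> in odd
  and in even position, and \<open>w\<^sub>i\<close> the difference of their exponents.  The parity hypothesis makes \<open>a\<^sub>i b\<^sub>j\<close>
  and \<open>b\<^sub>i a\<^sub>j\<close> have the same image, so each \<open>w\<^sub>i - w\<^sub>j\<close> is a relation on the vertices of \<open>P\<^sub>i\<close> and \<open>P\<^sub>j\<close>.
  Expand \<open>w\<^sub>1 - w\<^sub>2 = (w\<^sub>1 - w\<^sub>3) - (w\<^sub>2 - w\<^sub>3)\<close> in \<open>B\<close>: by uniqueness of the coefficients, a basis vector
  occurring on the left lives on the vertices of two different pairs of paths, hence on those of \<open>P\<^sub>1\<close> or
  those of \<open>P\<^sub>2\<close> alone.  So \<open>w\<^sub>1 - w\<^sub>2\<close> is a relation on \<open>P\<^sub>1\<close> plus a relation on \<open>P\<^sub>2\<close>; as edges inside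
  both vertex sets can only be \<open>xy\<close>, the vector \<open>w\<^sub>1\<close> itself is a relation up to a multiple of \<open>xy\<close>.
  Its vertex degrees would then be a multiple of \<open>x + y\<close>, and \<open>0\<close> if \<open>xy\<close> is no edge.  But they are \<open>x - y\<close>
  for even paths, and \<open>x + y\<close> for odd ones, where \<open>xy\<close> is assumed not to be an edge.

  The basis comes from counting.  Join two monomials of the same image if they share a variable, and choose one
  component in each fibre of the monomial map as its root.  The differences between the other components and their roots span
  all relations, compatibly with supports, by induction on the image (\<open>vec_diff_in_span\<close>).  For a component
  \<open>K\<close>, the sum of the coefficients over \<open>K\<close> is a functional on \<open>P\<close> that kills the products of
  elements of \<open>P\<close> with polynomials without constant term, and
  these functionals show that there are at most \<open>\<mu>(P)\<close> nonroot components
  (\<open>card_branches_le\<close>).  On the other hand \<open>ht(P) \<le> n - r\<close>, where \<open>r\<close> is the size of a maximal set of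
  edges whose images are algebraically independent (\<open>height_le\<close>), and there are \<open>n - r\<close> linearly
  independent relations.  So \<open>\<mu>(P) = ht(P)\<close> forces the spanning family to be linearly independent.
\<close>

abbreviation lookup :: "('a \<Rightarrow>\<^sub>0 'b::zero) \<Rightarrow> 'a \<Rightarrow> 'b" where "lookup \<equiv> Poly_Mapping.lookup"
abbreviation keys :: "('a \<Rightarrow>\<^sub>0 'b::zero) \<Rightarrow> 'a set" where "keys \<equiv> Poly_Mapping.keys"
abbreviation single :: "'a \<Rightarrow> 'b \<Rightarrow> ('a \<Rightarrow>\<^sub>0 'b::zero)" where "single \<equiv> Poly_Mapping.single"

section \<open>Linear algebra\<close>

lemma (in vector_space) independent_family_of_minimal_size:
  assumes I: "finite I" and A: "independent A" "finite A" "A \<subseteq> span (f ` I)"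
    and card: "card I \<le> card A"
  shows "inj_on f I \<and> independent (f ` I)"
proof
  have "card A \<le> card (f ` I)"
    using independent_span_bound[of "f ` I" A] A I by auto
  with card card_image_le[OF I, of f] have eq: "card (f ` I) = card I" "card (f ` I) \<le> card A" by auto
  then show "inj_on f I" using I by (simp add: eq_card_imp_inj_on)
  show "independent (f ` I)"
  proof
    assume "dependent (f ` I)"
    then obtain x where x: "x \<in> f ` I" "x \<in> span (f ` I - {x})"
      by (auto simp: dependent_def)
    then have "span (f ` I) = span (f ` I - {x})"
      by (metis insert_Diff span_redundant)
    then have "card A \<le> card (f ` I - {x})"
      using independent_span_bound[of "f ` I - {x}" A] A I by auto
    also have "\<dots> < card (f ` I)" using x I by (intro card_Diff1_less) auto
    finally show False using eq card by simp
  qed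
qed

text \<open>Stated for families, so that repeated vectors count as a relation.\<close>

lemma (in vector_space) exists_linear_relation:
  assumes I: "finite I" and B: "finite B" "f ` I \<subseteq> span B" and card: "card B < card I"
  shows "\<exists>c. (\<exists>i\<in>I. c i \<noteq> 0) \<and> (\<Sum>i\<in>I. c i *s f i) = 0"
proof (cases "inj_on f I")
  case True
  have "dependent (f ` I)"
  proof (rule ccontr)
    assume "independent (f ` I)"
    then have "card (f ` I) \<le> card B" using independent_span_bound B by blast
    then show False using card True by (simp add: card_image)
  qed
  then obtain u where u: "\<exists>v\<in>f ` I. u v \<noteq> 0" "(\<Sum>v\<in>f ` I. u v *s v) = 0"
    using dependent_finite[of "f ` I"] I by auto
  with True show ?thesis
    by (intro exI[of _ "u \<circ> f"]) (auto simp: sum.reindex)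
next
  case False
  then obtain i j where ij: "i \<in> I" "j \<in> I" "i \<noteq> j" "f i = f j" by (auto simp: inj_on_def)
  let ?c = "\<lambda>k. if k = i then 1 else if k = j then - 1 else 0"
  have "(\<Sum>k\<in>I. ?c k *s f k) = (\<Sum>k\<in>{i, j}. ?c k *s f k)"
    using ij I by (intro sum.mono_neutral_right) auto
  also have "\<dots> = 0" using ij by simp
  finally show ?thesis using ij by (intro exI[of _ ?c]) auto
qed

lemma (in vector_space) span_Int_of_independent:
  assumes ind: "independent B" and Y: "Y \<subseteq> B" "v \<in> span Y" and Z: "Z \<subseteq> B" "v \<in> span Z"
  shows "v \<in> span (Y \<inter> Z)"
proof -
  have vB: "v \<in> span B" using Y span_mono by blast
  have "representation B v = representation Y v" "representation B v = representation Z v"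
    using representation_extend[OF ind Y(2,1)] representation_extend[OF ind Z(2,1)] .
  then have "b \<in> Y \<inter> Z" if "representation B v b \<noteq> 0" for b
    using that representation_ne_zero by (metis IntI)
  then have "(\<Sum>b | representation B v b \<noteq> 0. representation B v b *s b) \<in> span (Y \<inter> Z)"
    by (intro span_sum span_scale span_base) auto
  then show ?thesis using sum_nonzero_representation_eq[OF ind vB] by simp
qed

interpretation fun_space: vector_space "\<lambda>(c::'k::field) (f::'i \<Rightarrow> 'k) i. c * f i"
  by unfold_locales (auto simp: fun_eq_iff algebra_simps)

lemma independent_diagonal:
  fixes f :: "'i \<Rightarrow> 'j \<Rightarrow> 'k::field"
  assumes off: "\<And>i j. i \<in> I \<Longrightarrow> j \<in> I \<Longrightarrow> i \<noteq> j \<Longrightarrow> f i (g j) = 0"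
    and diag: "\<And>i. i \<in> I \<Longrightarrow> f i (g i) \<noteq> 0"
  shows "inj_on f I \<and> fun_space.independent (f ` I)"
proof
  show inj: "inj_on f I" using off diag by (metis inj_onI)
  show "fun_space.independent (f ` I)"
    unfolding fun_space.independent_explicit_finite_subsets
  proof (intro allI impI ballI)
    fix S u v
    assume S: "S \<subseteq> f ` I" "finite S" and zero: "(\<Sum>v\<in>S. (\<lambda>i. u v * v i)) = 0" and v: "v \<in> S"
    then obtain i where i: "i \<in> I" "v = f i" by auto
    have "0 = (\<Sum>w\<in>S. (\<lambda>i. u w * w i)) (g i)" using zero by simp
    also have "\<dots> = (\<Sum>w\<in>S. u w * w (g i))"
      using S(2) by (induction S rule: finite_induct) (auto)
    also have "\<dots> = (\<Sum>w\<in>{v}. u w * w (g i))"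
    proof (rule sum.mono_neutral_right)
      show "\<forall>w\<in>S - {v}. u w * w (g i) = 0"
      proof
        fix w assume "w \<in> S - {v}"
        then obtain j where "j \<in> I" "w = f j" "j \<noteq> i" using S(1) i by auto
        then show "u w * w (g i) = 0" using off[of j i] i(1) by simp
      qed
    qed (use S v in auto)
    finally show "u v = 0" using diag[OF i(1)] i by simp
  qed
qed

section \<open>Algebraic independence modulo an ideal and heights of primes\<close>

lemma Const_0 [simp]: "Const 0 = 0" by (simp add: Const_def)
lemma Const_1 [simp]: "Const 1 = 1" by (simp add: Const_def)
lemma Const_add: "Const (a + b) = Const a + Const b" by (simp add: Const_def single_add)
lemma Const_mult: "Const (a * b) = Const a * Const b" by (simp add: Const_def mult_single)
lemma Const_mult_single: "Const c * single m a = single m (c * a)"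
  by (simp add: Const_def mult_single)

interpretation poly_space: vector_space "\<lambda>(c::'k::field) (p::('x, 'k) mpoly). Const c * p"
  by unfold_locales (auto simp: Const_add Const_mult algebra_simps)

lemma sum_of_terms: "(\<Sum>m\<in>keys p. single m (lookup p m)) = p"
proof (rule poly_mapping_eqI)
  fix m
  show "lookup (\<Sum>m\<in>keys p. single m (lookup p m)) m = lookup p m"
    by (simp add: lookup_sum lookup_single when_def sum.delta not_in_keys_iff_lookup_eq_zero)
qed

abbreviation polys :: "'x set \<Rightarrow> ('x, 'k::comm_ring_1) mpoly set" where
  "polys A \<equiv> carrier (polynomial_ring A)"

lemma polynomial_ring_simps [simp]:
  "p \<otimes>\<^bsub>polynomial_ring A\<^esub> q = p * q" "p \<oplus>\<^bsub>polynomial_ring A\<^esub> q = p + q"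
  "\<one>\<^bsub>polynomial_ring A\<^esub> = 1" "\<zero>\<^bsub>polynomial_ring A\<^esub> = 0"
  by (simp_all add: polynomial_ring_def)

lemma polys_iff: "p \<in> polys A \<longleftrightarrow> (\<forall>m\<in>keys p. keys m \<subseteq> A)"
  by (simp add: polynomial_ring_def)

lemma polys_mult: "p \<in> polys A \<Longrightarrow> q \<in> polys A \<Longrightarrow> p * q \<in> polys A"
  and polys_add: "p \<in> polys A \<Longrightarrow> q \<in> polys A \<Longrightarrow> p + q \<in> polys A"
proof -
  interpret cring "polynomial_ring A :: ('a, 'b) mpoly ring" by (rule cring_polynomial_ring)
  show "p \<in> polys A \<Longrightarrow> q \<in> polys A \<Longrightarrow> p * q \<in> polys A"
    "p \<in> polys A \<Longrightarrow> q \<in> polys A \<Longrightarrow> p + q \<in> polys A"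
    using m_closed[of p q] a_closed[of p q] by auto
qed

lemma polys_0: "0 \<in> polys A" and polys_1: "1 \<in> polys A"
  by (simp_all add: polys_iff)

lemma polys_single: "keys m \<subseteq> A \<Longrightarrow> single m c \<in> polys A"
  by (simp add: polys_iff)

lemma polys_Const: "Const c \<in> polys A"
  by (simp add: Const_def polys_single)

lemma polys_power: "p \<in> polys A \<Longrightarrow> p ^ n \<in> polys A"
  by (induction n) (auto intro: polys_mult polys_1)

lemma polys_sum: "(\<And>i. i \<in> I \<Longrightarrow> f i \<in> polys A) \<Longrightarrow> sum f I \<in> polys A"
  by (induction I rule: infinite_finite_induct) (auto intro: polys_add polys_0)

lemma polys_uminus: "p \<in> polys A \<Longrightarrow> - p \<in> polys A"
  by (simp add: polys_iff)

text \<open>Exponent vectors are lists, so that adjoining an element to a family splits off a first exponent.\<close>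

fun power_product :: "'a::comm_semiring_1 list \<Rightarrow> nat list \<Rightarrow> 'a" where
  "power_product (f # fs) (a # as) = f ^ a * power_product fs as"
| "power_product _ _ = 1"

definition exponents :: "nat \<Rightarrow> nat \<Rightarrow> nat list set" where
  "exponents D N = {as. set as \<subseteq> {..D} \<and> length as = N}"

definition poly_in :: "nat \<Rightarrow> (nat list \<Rightarrow> 'k::field) \<Rightarrow> ('x, 'k) mpoly list \<Rightarrow> ('x, 'k) mpoly" where
  "poly_in D c fs = (\<Sum>as\<in>exponents D (length fs). Const (c as) * power_product fs as)"

definition alg_independent :: "('x, 'k::field) mpoly set \<Rightarrow> ('x, 'k) mpoly list \<Rightarrow> bool" where
  "alg_independent Q fs \<longleftrightarrow>
     (\<forall>D c. poly_in D c fs \<in> Q \<longrightarrow> (\<forall>as\<in>exponents D (length fs). c as = 0))"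

lemma finite_exponents [simp]: "finite (exponents D N)"
  by (simp add: exponents_def finite_lists_length_eq)

lemma card_exponents: "card (exponents D N) = Suc D ^ N"
  by (simp add: exponents_def card_lists_length_eq)

lemma poly_in_Cons:
  "poly_in D c (f # fs) = (\<Sum>j\<le>D. f ^ j * poly_in D (\<lambda>as. c (j # as)) fs)"
proof -
  have ex: "exponents D (Suc N) = (\<lambda>(j, as). j # as) ` ({..D} \<times> exponents D N)" for N
    by (auto simp: exponents_def length_Suc_conv image_iff)
  have "poly_in D c (f # fs) =
      (\<Sum>(j, as)\<in>{..D} \<times> exponents D (length fs). Const (c (j # as)) * power_product (f # fs) (j # as))"
    unfolding poly_in_def list.size ex add_0_right add_Suc_right
    by (subst sum.reindex) (auto simp: inj_on_def case_prod_unfold)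
  also have "\<dots> = (\<Sum>j\<le>D. f ^ j * poly_in D (\<lambda>as. c (j # as)) fs)"
    by (simp add: sum.cartesian_product[symmetric] poly_in_def sum_distrib_left ac_simps)
  finally show ?thesis .
qed

lemma power_product_closed: "set fs \<subseteq> polys A \<Longrightarrow> power_product fs as \<in> polys A"
  by (induction fs as rule: power_product.induct) (auto intro: polys_mult polys_power polys_1)

lemma poly_in_closed: "set fs \<subseteq> polys A \<Longrightarrow> poly_in D c fs \<in> polys A"
  unfolding poly_in_def by (intro polys_sum polys_mult polys_Const power_product_closed)

lemma ideal_diff_mem:
  assumes Q: "ideal Q (polynomial_ring A :: ('x, 'k::field) mpoly ring)"
    and "p + q \<in> Q" "q \<in> Q"
  shows "p \<in> Q"
proof -
  interpret ideal Q "polynomial_ring A :: ('x, 'k) mpoly ring" by (rule Q)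
  have "- 1 \<in> (polys A :: ('x, 'k) mpoly set)" by (intro polys_uminus polys_1)
  then have "- 1 * q \<in> Q" using I_l_closed[of q "- 1"] assms(3) by simp
  from additive_subgroup.a_closed[OF ideal.axioms(1)[OF Q] assms(2) this] show ?thesis by simp
qed

text \<open>Order a relation \<open>\<Sum>\<^sub>j g\<^sub>j f\<^sup>j \<in> Q\<close> by powers of the new element.  Modulo \<open>Q'\<close> only \<open>g\<^sub>0\<close>
  survives, so \<open>g\<^sub>0\<close> is trivial by independence modulo \<open>Q'\<close>; as \<open>Q\<close> is prime and \<open>f \<notin> Q\<close>, a factor \<open>f\<close> can be
  cancelled from what remains.\<close>

lemma alg_independent_Cons:
  assumes Q: "primeideal Q (polynomial_ring A :: ('x, 'k::field) mpoly ring)"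
    and Q': "ideal Q' (polynomial_ring A)" and sub: "Q \<subseteq> Q'"
    and f: "f \<in> Q'" "f \<notin> Q" and fs: "set fs \<subseteq> polys A" and ind: "alg_independent Q' fs"
  shows "alg_independent Q (f # fs)"
proof -
  interpret Q: primeideal Q "polynomial_ring A :: ('x, 'k) mpoly ring" by (rule Q)
  interpret Q': ideal Q' "polynomial_ring A :: ('x, 'k) mpoly ring" by (rule Q')
  have fA: "f \<in> polys A" using f(1) Q'.a_subset by auto
  have relation_trivial: "\<forall>j\<le>J. \<forall>as\<in>exponents D (length fs). g j as = 0"
    if "(\<Sum>j\<le>J. f ^ j * poly_in D (g j) fs) \<in> Q" for D J g
    using that
  proof (induction J arbitrary: g)
    case 0
    then have "poly_in D (g 0) fs \<in> Q'" using sub by auto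
    then show ?case using ind by (auto simp: alg_independent_def)
  next
    case (Suc J)
    define rest where "rest = (\<Sum>j\<le>J. f ^ j * poly_in D (g (Suc j)) fs)"
    have split: "(\<Sum>j\<le>Suc J. f ^ j * poly_in D (g j) fs) = poly_in D (g 0) fs + f * rest"
      by (subst sum.atMost_Suc_shift) (simp add: rest_def sum_distrib_left ac_simps)
    have rest: "rest \<in> polys A"
      unfolding rest_def by (intro polys_sum polys_mult polys_power fA poly_in_closed fs)
    have "f * rest \<in> Q'" using Q'.I_r_closed[OF f(1) rest] by simp
    then have "poly_in D (g 0) fs \<in> Q'"
      using Suc.prems sub ideal_diff_mem[OF Q'] unfolding split by blast
    then have g0: "\<forall>as\<in>exponents D (length fs). g 0 as = 0"
      using ind by (auto simp: alg_independent_def)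
    then have "poly_in D (g 0) fs = 0" by (simp add: poly_in_def)
    then have "f * rest \<in> Q" using Suc.prems unfolding split by simp
    then have "rest \<in> Q" using Q.I_prime[OF fA rest] f(2) by auto
    then have "\<forall>j\<le>J. \<forall>as\<in>exponents D (length fs). g (Suc j) as = 0"
      using Suc.IH[of "\<lambda>j. g (Suc j)"] by (simp add: rest_def)
    with g0 show ?case by (metis Suc_le_mono not0_implies_Suc)
  qed
  show ?thesis unfolding alg_independent_def
  proof (intro allI impI ballI)
    fix D c as assume mem: "poly_in D c (f # fs) \<in> Q" and as: "as \<in> exponents D (length (f # fs))"
    obtain j bs where bs: "as = j # bs" "j \<le> D" "bs \<in> exponents D (length fs)"
      using as by (cases as) (auto simp: exponents_def)
    then show "c as = 0"
      using relation_trivial[of D "\<lambda>j as. c (j # as)" D] mem unfolding poly_in_Cons by auto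
  qed
qed

definition box :: "'x set \<Rightarrow> nat \<Rightarrow> ('x \<Rightarrow>\<^sub>0 nat) set" where
  "box A B = {m. keys m \<subseteq> A \<and> (\<forall>x. lookup m x \<le> B)}"

lemma finite_box: "finite A \<Longrightarrow> finite (box A B)" and card_box: "finite A \<Longrightarrow> card (box A B) \<le> Suc B ^ card A"
proof -
  assume A: "finite A"
  have inj: "inj_on (\<lambda>m. restrict (lookup m) A) (box A B)"
  proof (rule inj_onI)
    fix m m' assume m: "m \<in> box A B" "m' \<in> box A B" and eq: "restrict (lookup m) A = restrict (lookup m') A"
    show "m = m'"
    proof (rule poly_mapping_eqI)
      fix x show "lookup m x = lookup m' x"
        using fun_cong[OF eq, of x] m unfolding box_def restrict_def mem_Collect_eq
        by (cases "x \<in> A") (auto, metis in_keys_iff subsetD)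
    qed
  qed
  have im: "(\<lambda>m. restrict (lookup m) A) ` box A B \<subseteq> (\<Pi>\<^sub>E x\<in>A. {..B})"
    by (auto simp: box_def)
  have fin: "finite (\<Pi>\<^sub>E x\<in>A. {..B})" using A by (intro finite_PiE) auto
  show "finite (box A B)" using inj im fin by (metis finite_imageD finite_subset)
  show "card (box A B) \<le> Suc B ^ card A"
    using card_inj_on_le[OF inj im fin] A by (simp add: card_PiE)
qed

lemma box_mult:
  assumes "keys p \<subseteq> box A B" "keys q \<subseteq> box A C"
  shows "keys (p * q) \<subseteq> box A (B + C)"
proof
  fix m assume "m \<in> keys (p * q)"
  then obtain a b where ab: "m = a + b" "a \<in> box A B" "b \<in> box A C"
    using keys_mult[of p q] assms by blast
  then show "m \<in> box A (B + C)"
    using Poly_Mapping.keys_add[of a b] by (auto simp: box_def lookup_add intro: add_mono)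
qed

lemma box_power: "keys p \<subseteq> box A B \<Longrightarrow> keys (p ^ n) \<subseteq> box A (n * B)"
proof (induction n)
  case 0 show ?case by (simp add: box_def)
next
  case (Suc n) then show ?case using box_mult[of p A B "p ^ n" "n * B"] by simp
qed

lemma box_mono: "B \<le> C \<Longrightarrow> box A B \<subseteq> box A C"
  by (auto simp: box_def intro: order_trans)

lemma box_power_product:
  assumes "\<forall>f\<in>set fs. keys f \<subseteq> box A B" "as \<in> exponents D (length fs)"
  shows "keys (power_product fs as) \<subseteq> box A (length fs * (D * B))"
  using assms
proof (induction fs arbitrary: as)
  case Nil then show ?case by (simp add: exponents_def box_def)
next
  case (Cons f fs)
  obtain a bs where bs: "as = a # bs" "a \<le> D" "bs \<in> exponents D (length fs)"
    using Cons.prems by (cases as) (auto simp: exponents_def)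
  have "keys (f ^ a) \<subseteq> box A (D * B)"
    using box_power[of f A B a] Cons.prems(1) box_mono[of "a * B" "D * B" A] bs(2) by auto
  then have "keys (f ^ a * power_product fs bs) \<subseteq> box A (D * B + length fs * (D * B))"
    using Cons bs by (intro box_mult) auto
  then show ?case by (simp add: bs)
qed

text \<open>Transcendence degree by counting: the products of \<open>N\<close> polynomials with exponents up to \<open>D\<close>
  number \<open>(D + 1)\<^sup>N\<close>, but they all lie in a space of dimension \<open>O(D\<^sup>n)\<close>, where \<open>n\<close> is the number of variables.\<close>

lemma length_alg_independent_le:
  fixes fs :: "('x, 'k::field) mpoly list"
  assumes A: "finite A" and fs: "set fs \<subseteq> polys A" and Q: "0 \<in> Q" and ind: "alg_independent Q fs"
  shows "length fs \<le> card A"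
proof (rule ccontr)
  assume "\<not> length fs \<le> card A"
  then have len: "card A < length fs" by simp
  define X where "X = (\<Union>f\<in>set fs. \<Union>m\<in>keys f. lookup m ` keys m)"
  have X: "finite X" by (simp add: X_def)
  define B where "B = Max (insert 0 X)"
  have lookup_le: "lookup m x \<le> B" if "f \<in> set fs" "m \<in> keys f" for f m x
  proof (cases "x \<in> keys m")
    case True
    then have "lookup m x \<in> X" using that by (auto simp: X_def)
    then show ?thesis using X by (simp add: B_def)
  qed (simp add: not_in_keys_iff_lookup_eq_zero)
  have fs_box: "\<forall>f\<in>set fs. keys f \<subseteq> box A B"
    using lookup_le fs unfolding box_def polys_iff subset_iff[of "set fs"] by blast
  \<comment> \<open>All exponents in the products are at most \<open>N D B\<close>, and \<open>N D B + 1 \<le> C (D + 1)\<close>; the choice of \<open>D\<close>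
    makes \<open>(C (D + 1))\<^sup>n = D (D + 1)\<^sup>n\<close> smaller than \<open>(D + 1)\<^sup>n\<^sup>+\<^sup>1\<close>.\<close>
  define C where "C = Suc (length fs * B)"
  define D where "D = C ^ card A"
  define N where "N = length fs"
  let ?T = "(\<lambda>m. single m (1::'k)) ` box A (N * (D * B))"
  have "power_product fs ` exponents D N \<subseteq> poly_space.span ?T"
  proof
    fix p assume "p \<in> power_product fs ` exponents D N"
    then have p: "keys p \<subseteq> box A (N * (D * B))" using box_power_product[OF fs_box] by (auto simp: N_def)
    have "(\<Sum>m\<in>keys p. Const (lookup p m) * single m 1) \<in> poly_space.span ?T"
      using p by (intro poly_space.span_sum poly_space.span_scale poly_space.span_base) auto
    then show "p \<in> poly_space.span ?T" by (simp add: Const_mult_single sum_of_terms)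
  qed
  moreover have "card ?T < card (exponents D N)"
  proof -
    have "card ?T \<le> card (box A (N * (D * B)))" using finite_box[OF A] by (rule card_image_le)
    also have "\<dots> \<le> Suc (N * (D * B)) ^ card A" by (rule card_box[OF A])
    also have "\<dots> \<le> (C * Suc D) ^ card A" by (intro power_mono) (auto simp: C_def N_def)
    also have "\<dots> = D * Suc D ^ card A" by (simp only: power_mult_distrib D_def[symmetric])
    also have "\<dots> < Suc D * Suc D ^ card A" by simp
    also have "\<dots> = Suc D ^ Suc (card A)" by simp
    also have "\<dots> \<le> Suc D ^ N" using len by (intro power_increasing) (auto simp: N_def)
    finally show ?thesis by (simp add: card_exponents)
  qed
  ultimately obtain c where c: "\<exists>as\<in>exponents D N. c as \<noteq> 0"
      "(\<Sum>as\<in>exponents D N. Const (c as) * power_product fs as) = 0"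
    using poly_space.exists_linear_relation[of "exponents D N" ?T "power_product fs"] finite_box[OF A] by auto
  then have "poly_in D c fs \<in> Q" using Q by (simp add: poly_in_def N_def)
  then show False using ind c(1) by (auto simp: alg_independent_def N_def)
qed

text \<open>Descending a chain of primes below \<open>P\<close>, each proper inclusion supplies one more algebraically
  independent element, and there can be no more of them than variables.\<close>

lemma height_le:
  fixes P :: "('x, 'k::field) mpoly set"
  assumes A: "finite A" and fs: "set fs \<subseteq> polys A" and ind: "alg_independent P fs"
  shows "height (polynomial_ring A) P \<le> enat (card A - length fs)"
proof -
  have "h \<le> card A - length fs"
    if Q: "\<forall>i\<le>h. primeideal (Q i) (polynomial_ring A)" "\<forall>i<h. Q i \<subset> Q (Suc i)" and P: "Q h = P" for h Q
  proof -
    have "\<exists>gs. length gs = i + length fs \<and> set gs \<subseteq> polys A \<and> alg_independent (Q (h - i)) gs" if "i \<le> h" for i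
      using that
    proof (induction i)
      case 0 then show ?case using fs ind P by auto
    next
      case (Suc i)
      then obtain gs where gs: "length gs = i + length fs" "set gs \<subseteq> polys A" "alg_independent (Q (h - i)) gs"
        by auto
      define j where "j = h - Suc i"
      have j: "Suc j = h - i" "j < h" using Suc.prems by (auto simp: j_def)
      obtain f where f: "f \<in> Q (Suc j)" "f \<notin> Q j" using Q(2) j(2) by blast
      have ideal: "ideal (Q (Suc j)) (polynomial_ring A)" using Q(1) j by (simp add: primeideal.axioms(1))
      then have "f \<in> polys A" using f(1) ideal.Icarr[OF ideal] by simp
      moreover have "alg_independent (Q j) (f # gs)"
      proof (rule alg_independent_Cons[OF _ ideal _ f gs(2)])
        show "primeideal (Q j) (polynomial_ring A)" using Q(1) j(2) by simp
        show "Q j \<subseteq> Q (Suc j)" using Q(2) j(2) by blast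
        show "alg_independent (Q (Suc j)) gs" using gs(3) j(1) by simp
      qed
      ultimately show ?case using gs by (intro exI[of _ "f # gs"]) (auto simp: j_def)
    qed
    from this[of h] obtain gs where gs: "length gs = h + length fs" "set gs \<subseteq> polys A" "alg_independent (Q 0) gs"
      by auto
    have "ideal (Q 0) (polynomial_ring A)" using Q(1) by (simp add: primeideal.axioms(1))
    then have "0 \<in> Q 0" using additive_subgroup.zero_closed[OF ideal.axioms(1)] by fastforce
    then have "length gs \<le> card A" using length_alg_independent_le[OF A gs(2) _ gs(3)] by simp
    then show ?thesis using gs(1) by simp
  qed
  then show ?thesis unfolding height_def by (intro Sup_least) auto
qed

section \<open>Fibres of a monomial map\<close>

definition coeff_sum :: "('x \<Rightarrow>\<^sub>0 nat) set \<Rightarrow> ('x, 'k::field) mpoly \<Rightarrow> 'k" where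
  "coeff_sum K p = (\<Sum>m\<in>keys p \<inter> K. lookup p m)"

lemma coeff_sum_superset:
  assumes "finite F" "keys p \<subseteq> F"
  shows "coeff_sum K p = (\<Sum>m\<in>F. if m \<in> K then lookup p m else 0)"
proof -
  have "(\<Sum>m\<in>F. if m \<in> K then lookup p m else 0) = (\<Sum>m\<in>F \<inter> K. lookup p m)"
    using assms(1) by (simp add: sum.inter_restrict)
  also have "\<dots> = coeff_sum K p"
    unfolding coeff_sum_def using assms
    by (intro sum.mono_neutral_right) (auto simp: subset_iff in_keys_iff)
  finally show ?thesis by simp
qed

lemma coeff_sum_0 [simp]: "coeff_sum K 0 = 0" by (simp add: coeff_sum_def)

lemma coeff_sum_single [simp]: "coeff_sum K (single m c) = (if m \<in> K then c else 0)"
  by (simp add: coeff_sum_superset[of "{m}"])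

lemma coeff_sum_add: "coeff_sum K (p + q) = coeff_sum K p + coeff_sum K q"
proof -
  let ?F = "keys p \<union> keys q"
  have "coeff_sum K (p + q) = (\<Sum>m\<in>?F. if m \<in> K then lookup (p + q) m else 0)"
    using Poly_Mapping.keys_add[of p q] by (intro coeff_sum_superset) auto
  also have "\<dots> = (\<Sum>m\<in>?F. if m \<in> K then lookup p m else 0) + (\<Sum>m\<in>?F. if m \<in> K then lookup q m else 0)"
    by (subst sum.distrib[symmetric]) (auto simp: lookup_add intro!: sum.cong)
  also have "\<dots> = coeff_sum K p + coeff_sum K q"
    by (simp add: coeff_sum_superset[of ?F])
  finally show ?thesis .
qed

lemma coeff_sum_sum: "coeff_sum K (sum f I) = (\<Sum>i\<in>I. coeff_sum K (f i))"
  by (induction I rule: infinite_finite_induct) (auto simp: coeff_sum_add)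

lemma coeff_sum_diff: "coeff_sum K (p - q) = coeff_sum K p - coeff_sum K q"
  using coeff_sum_add[of K "p - q" q] by simp

locale monomial_map =
  fixes E :: "'x set" and d :: "'x \<Rightarrow> ('y \<Rightarrow>\<^sub>0 nat)"
  assumes finite_E: "finite E" and d_nonzero: "\<And>e. e \<in> E \<Longrightarrow> d e \<noteq> 0"
begin

definition deg :: "('x \<Rightarrow>\<^sub>0 nat) \<Rightarrow> ('y \<Rightarrow>\<^sub>0 nat)" where
  "deg m = (\<Sum>e\<in>keys m. \<Sum>i<lookup m e. d e)"

definition monomials :: "'x set \<Rightarrow> ('x \<Rightarrow>\<^sub>0 nat) set" where
  "monomials T = {m. keys m \<subseteq> T}"

definition toric :: "('x, 'k::field) mpoly set" where
  "toric = {p \<in> polys E. \<forall>\<beta>. coeff_sum {m. deg m = \<beta>} p = 0}"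

lemma lookup_deg_superset:
  assumes "finite F" "keys m \<subseteq> F"
  shows "lookup (deg m) v = (\<Sum>e\<in>F. lookup m e * lookup (d e) v)"
proof -
  have "lookup (deg m) v = (\<Sum>e\<in>keys m. lookup m e * lookup (d e) v)"
    by (simp add: deg_def lookup_sum)
  also have "\<dots> = (\<Sum>e\<in>F. lookup m e * lookup (d e) v)"
    using assms by (intro sum.mono_neutral_left) (auto simp: not_in_keys_iff_lookup_eq_zero)
  finally show ?thesis .
qed

lemma deg_add: "deg (m + m') = deg m + deg m'"
proof (rule poly_mapping_eqI)
  fix v
  let ?F = "keys m \<union> keys m'"
  have "lookup (deg (m + m')) v = (\<Sum>e\<in>?F. lookup (m + m') e * lookup (d e) v)"
    using Poly_Mapping.keys_add[of m m'] by (intro lookup_deg_superset) auto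
  also have "\<dots> = (\<Sum>e\<in>?F. lookup m e * lookup (d e) v) + (\<Sum>e\<in>?F. lookup m' e * lookup (d e) v)"
    by (simp add: lookup_add algebra_simps sum.distrib)
  also have "\<dots> = lookup (deg m + deg m') v"
    by (simp add: lookup_deg_superset[of ?F] lookup_add)
  finally show "lookup (deg (m + m')) v = lookup (deg m + deg m') v" .
qed

lemma deg_single [simp]: "deg (single e (Suc 0)) = d e"
  by (simp add: deg_def)

lemma deg_0 [simp]: "deg 0 = 0" by (simp add: deg_def)

lemma keys_deg_add: "keys (deg (m + m')) = keys (deg m) \<union> keys (deg m')"
  by (auto simp: deg_add lookup_add in_keys_iff)

lemma monomials_add: "m + m' \<in> monomials T \<longleftrightarrow> m \<in> monomials T \<and> m' \<in> monomials T"
proof -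
  have "keys (m + m') = keys m \<union> keys m'" by (auto simp: lookup_add in_keys_iff)
  then show ?thesis by (simp add: monomials_def)
qed

lemma monomial_split:
  assumes "e \<in> keys m"
  obtains m' :: "'x \<Rightarrow>\<^sub>0 nat" where "m = single e 1 + m'"
proof
  show "m = single e 1 + (m - single e 1)"
    using assms by (intro poly_mapping_eqI) (auto simp: lookup_add lookup_minus lookup_single when_def in_keys_iff)
qed

subsection \<open>Components of fibres\<close>

text \<open>Two monomials of the same degree that share a variable differ by a variable times a binomial
  of smaller degree, so binomials inside a component are redundant as generators.\<close>

definition linked :: "(('x \<Rightarrow>\<^sub>0 nat) \<times> ('x \<Rightarrow>\<^sub>0 nat)) set" where
  "linked = {(u, v). u \<in> monomials E \<and> v \<in> monomials E \<and> deg u = deg v \<and> keys u \<inter> keys v \<noteq> {}}\<^sup>*"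

definition component :: "('x \<Rightarrow>\<^sub>0 nat) \<Rightarrow> ('x \<Rightarrow>\<^sub>0 nat) set" where
  "component u = {v. (u, v) \<in> linked}"

lemma linked_refl: "(u, u) \<in> linked" by (simp add: linked_def)

lemma linked_sym: "(u, v) \<in> linked \<Longrightarrow> (v, u) \<in> linked"
proof -
  have "sym {(u, v). u \<in> monomials E \<and> v \<in> monomials E \<and> deg u = deg v \<and> keys u \<inter> keys v \<noteq> {}}"
    by (auto simp: sym_def)
  then show "(u, v) \<in> linked \<Longrightarrow> (v, u) \<in> linked"
    unfolding linked_def by (blast dest: sym_rtrancl symD)
qed

lemma linked_trans: "(u, v) \<in> linked \<Longrightarrow> (v, w) \<in> linked \<Longrightarrow> (u, w) \<in> linked"
  by (auto simp: linked_def)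

lemma component_eq: "v \<in> component u \<Longrightarrow> component v = component u"
  unfolding component_def using linked_sym linked_trans by blast

lemma linked_deg:
  assumes "(u, v) \<in> linked" shows "deg u = deg v" "u \<in> monomials E \<longleftrightarrow> v \<in> monomials E"
  using assms unfolding linked_def by (induction rule: rtrancl_induct) auto

lemma linked_shift:
  assumes "u \<in> monomials E" "v \<in> monomials E" "a \<in> monomials E" "deg u = deg v" "a \<noteq> 0"
  shows "(a + u, a + v) \<in> linked"
proof -
  obtain e where "e \<in> keys a" using assms(5) by fastforce
  then have "e \<in> keys (a + u) \<inter> keys (a + v)" by (simp add: in_keys_iff lookup_add)
  then show ?thesis unfolding linked_def using assms
    by (intro r_into_rtrancl) (auto simp: deg_add monomials_add)
qed

text \<open>A product with a nonconstant monomial \<open>a\<close> sends a whole fibre into a single component, since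
  all the products share the variables of \<open>a\<close>; so it contributes a full fibre sum of \<open>p\<close>, which is \<open>0\<close>,
  or nothing.  Hence these functionals factor through the quotient of the toric ideal by its product with the
  ideal of all variables.\<close>

lemma coeff_sum_component_mult:
  fixes p g :: "('x, 'k::field) mpoly"
  assumes p: "p \<in> toric" and g: "g \<in> polys E"
  shows "coeff_sum (component c) (g * p) = lookup g 0 * coeff_sum (component c) p"
proof -
  let ?K = "component c"
  have keys_p: "m \<in> monomials E" if "m \<in> keys p" for m
    using p that by (auto simp: toric_def polys_iff monomials_def)
  have term_mult: "coeff_sum ?K (single a x * p) = (if a = 0 then x else 0) * coeff_sum ?K p"
    if a: "a \<in> monomials E" for a x
  proof -
    have "single a x * p = (\<Sum>m\<in>keys p. single (a + m) (x * lookup p m))"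
      by (subst (2) sum_of_terms[symmetric]) (simp add: sum_distrib_left mult_single del: sum_of_terms)
    then have expand: "coeff_sum ?K (single a x * p)
        = x * (\<Sum>m\<in>keys p. if a + m \<in> ?K then lookup p m else 0)"
      by (simp add: coeff_sum_sum sum_distrib_left if_distrib cong: if_cong)
    show ?thesis
    proof (cases "a = 0")
      case True
      then show ?thesis unfolding expand by (simp add: coeff_sum_superset[of "keys p"])
    next
      case False
      have "(\<Sum>m\<in>keys p. if a + m \<in> ?K then lookup p m else 0) = 0"
      proof (cases "\<exists>m0\<in>keys p. a + m0 \<in> ?K")
        case True
        then obtain m0 where m0: "m0 \<in> keys p" "a + m0 \<in> ?K" by blast
        have "a + m \<in> ?K \<longleftrightarrow> deg m = deg m0" if m: "m \<in> keys p" for m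
        proof
          assume "a + m \<in> ?K"
          then have "deg (a + m) = deg (a + m0)"
            using linked_deg(1) m0(2) unfolding component_def by (metis mem_Collect_eq)
          then show "deg m = deg m0" by (simp add: deg_add)
        next
          assume "deg m = deg m0"
          then have "(a + m0, a + m) \<in> linked" using linked_shift[of m0 m a] a False m m0(1) keys_p by simp
          then show "a + m \<in> ?K" using m0(2) linked_trans unfolding component_def by blast
        qed
        then have "(\<Sum>m\<in>keys p. if a + m \<in> ?K then lookup p m else 0)
            = (\<Sum>m\<in>keys p. if m \<in> {m. deg m = deg m0} then lookup p m else 0)"
          by (intro sum.cong) auto
        also have "\<dots> = coeff_sum {m. deg m = deg m0} p" by (simp add: coeff_sum_superset[of "keys p"])
        finally show ?thesis using p by (simp add: toric_def)
      qed (auto intro: sum.neutral)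
      then show ?thesis using False expand by simp
    qed
  qed
  have "g * p = (\<Sum>a\<in>keys g. single a (lookup g a) * p)"
    by (subst sum_of_terms[symmetric, of g]) (simp add: sum_distrib_right)
  then have "coeff_sum ?K (g * p) = (\<Sum>a\<in>keys g. (if a = 0 then lookup g a else 0) * coeff_sum ?K p)"
    using g term_mult by (simp add: coeff_sum_sum polys_iff monomials_def)
  also have "\<dots> = (\<Sum>a\<in>keys g. if a = 0 then lookup g a * coeff_sum ?K p else 0)"
    by (intro sum.cong) auto
  also have "\<dots> = lookup g 0 * coeff_sum ?K p"
    by (simp add: sum.delta not_in_keys_iff_lookup_eq_zero)
  finally show ?thesis .
qed

definition root :: "('y \<Rightarrow>\<^sub>0 nat) \<Rightarrow> ('x \<Rightarrow>\<^sub>0 nat)" where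
  "root \<beta> = (SOME u. u \<in> monomials E \<and> deg u = \<beta>)"

lemma root:
  assumes "u \<in> monomials E" shows "root (deg u) \<in> monomials E" "deg (root (deg u)) = deg u"
  using someI[of "\<lambda>v. v \<in> monomials E \<and> deg v = deg u" u] assms by (auto simp: root_def)

definition rep :: "('x \<Rightarrow>\<^sub>0 nat) set \<Rightarrow> ('x \<Rightarrow>\<^sub>0 nat)" where
  "rep K = (SOME u. u \<in> K)"

text \<open>A minimal set of binomials generating the toric ideal can be chosen to consist of one
  binomial for each of these components, joining it to the root component of its fibre.\<close>

definition branches :: "('x \<Rightarrow>\<^sub>0 nat) set set" where
  "branches = {component u | u. u \<in> monomials E \<and> root (deg u) \<notin> component u}"

lemma branch_rep:
  assumes "K \<in> branches"
  shows "component (rep K) = K" "rep K \<in> K" "rep K \<in> monomials E" "root (deg (rep K)) \<notin> K"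
    "root (deg (rep K)) \<in> monomials E" "deg (root (deg (rep K))) = deg (rep K)"
proof -
  obtain u where u: "K = component u" "u \<in> monomials E" "root (deg u) \<notin> component u"
    using assms by (auto simp: branches_def)
  have "u \<in> K" using u linked_refl by (simp add: component_def)
  then show rep: "rep K \<in> K" unfolding rep_def by (rule someI)
  then show "component (rep K) = K" using u component_eq by simp
  have "(u, rep K) \<in> linked" using rep u by (simp add: component_def)
  from linked_deg[OF this] show mono: "rep K \<in> monomials E" and "root (deg (rep K)) \<notin> K" using u by auto
  show "root (deg (rep K)) \<in> monomials E" "deg (root (deg (rep K))) = deg (rep K)"
    using root[OF mono] by auto
qed

lemma single_diff_in_toric:
  assumes "u \<in> monomials E" "v \<in> monomials E" "deg u = deg v"
  shows "single u 1 - single v 1 \<in> toric"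
proof -
  have "single u 1 + - single v 1 \<in> polys E"
    using assms by (intro polys_add polys_uminus polys_single) (auto simp: monomials_def)
  then show ?thesis using assms by (auto simp: toric_def coeff_sum_diff)
qed

text \<open>The coefficient sums over the nonroot components take the binomials that join these components to
  their roots to unit vectors, while their values on the whole ideal are spanned by those on the generators.\<close>

lemma card_branches_le:
  fixes S :: "('x, 'k::field) mpoly set"
  assumes S: "finite S" and gen: "genideal (polynomial_ring E) S = toric" and sub: "S \<subseteq> polys E"
  shows "finite branches \<and> card branches \<le> card S"
proof -
  interpret cring "polynomial_ring E :: ('x, 'k) mpoly ring" by (rule cring_polynomial_ring)
  define \<Phi> :: "('x, 'k) mpoly \<Rightarrow> ('x \<Rightarrow>\<^sub>0 nat) set \<Rightarrow> 'k" where
    "\<Phi> p = (\<lambda>K. if K \<in> branches then coeff_sum K p else 0)" for p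
  have \<Phi>_add: "\<Phi> (p + q) = \<Phi> p + \<Phi> q" for p q
    by (auto simp: \<Phi>_def fun_eq_iff coeff_sum_add)
  have \<Phi>_mult: "\<Phi> (g * p) = (\<lambda>K. lookup g 0 * \<Phi> p K)" if "p \<in> toric" "g \<in> polys E" for g p
  proof
    fix K
    have "coeff_sum K (g * p) = lookup g 0 * coeff_sum K p" if "K \<in> branches"
      using coeff_sum_component_mult[OF \<open>p \<in> toric\<close> \<open>g \<in> polys E\<close>, of "rep K"] branch_rep(1)[OF that] by simp
    then show "\<Phi> (g * p) K = lookup g 0 * \<Phi> p K" by (simp add: \<Phi>_def)
  qed
  have toric_ideal: "ideal toric (polynomial_ring E :: ('x, 'k) mpoly ring)"
    using genideal_ideal[OF sub] gen by simp
  then interpret T: ideal "toric :: ('x, 'k) mpoly set" "polynomial_ring E" .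
  \<comment> \<open>\<open>J\<close> is an ideal since \<open>\<Phi>\<close> is linear over the constant terms of the coefficients; it contains \<open>S\<close>,
    hence is everything.\<close>
  define J where "J = {p \<in> toric. \<Phi> p \<in> fun_space.span (\<Phi> ` S)}"
  have J_add: "p + q \<in> J" if "p \<in> J" "q \<in> J" for p q
    using that T.a_closed[of p q] fun_space.span_add by (auto simp: J_def \<Phi>_add)
  have J_mult: "g * p \<in> J" if "g \<in> polys E" "p \<in> J" for g p
    using that T.I_l_closed[of p g] fun_space.span_scale[of "\<Phi> p" _ "lookup g 0"] by (auto simp: J_def \<Phi>_mult)
  have "\<Phi> 0 = 0" by (auto simp: \<Phi>_def fun_eq_iff)
  then have J_0: "0 \<in> J" using T.zero_closed fun_space.span_zero by (auto simp: J_def)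
  have J_sub: "J \<subseteq> polys E"
    using T.a_subset by (auto simp: J_def)
  have "ideal J (polynomial_ring E)"
  proof (rule idealI)
    show "ring (polynomial_ring E :: ('x, 'k) mpoly ring)" by (rule ring_axioms)
    show "subgroup J (add_monoid (polynomial_ring E))"
    proof (rule add.subgroupI)
      show "J \<subseteq> polys E" by (rule J_sub)
      show "J \<noteq> {}" using J_0 by blast
      show "\<ominus>\<^bsub>polynomial_ring E\<^esub> p \<in> J" if "p \<in> J" for p
      proof -
        have p: "p \<in> polys E" using that J_sub by blast
        have "\<ominus>\<^bsub>polynomial_ring E\<^esub> p = - 1 * p"
          using p polys_uminus[OF p] by (intro minus_equality) auto
        then show ?thesis using J_mult[OF polys_uminus[OF polys_1] that] by simp
      qed
    qed (use J_add in auto)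
    show "x \<otimes>\<^bsub>polynomial_ring E\<^esub> a \<in> J" "a \<otimes>\<^bsub>polynomial_ring E\<^esub> x \<in> J" if "a \<in> J" "x \<in> polys E" for a x
      using J_mult[OF that(2,1)] by (simp_all add: mult.commute)
  qed
  moreover have "S \<subseteq> J"
  proof
    fix s assume "s \<in> S"
    then have "s \<in> toric" "\<Phi> s \<in> fun_space.span (\<Phi> ` S)"
      using genideal_self[OF sub] gen by (auto intro: fun_space.span_base)
    then show "s \<in> J" by (simp add: J_def)
  qed
  ultimately have "toric \<subseteq> J" using genideal_minimal[of J S] gen by simp
  define f where "f K = \<Phi> (single (rep K) 1 - single (root (deg (rep K))) 1)" for K
  have unit: "f K K' = (if K = K' then 1 else 0)" if "K \<in> branches" "K' \<in> branches" for K K'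
  proof -
    have "rep K \<in> K' \<longleftrightarrow> K = K'"
      using branch_rep[OF that(1)] branch_rep[OF that(2)] component_eq by metis
    moreover have "root (deg (rep K)) \<notin> K'"
    proof
      assume a: "root (deg (rep K)) \<in> K'"
      then have "(rep K', root (deg (rep K))) \<in> linked"
        using branch_rep(1)[OF that(2)] by (auto simp: component_def)
      then have "deg (rep K') = deg (rep K)" using linked_deg(1) branch_rep(6)[OF that(1)] by metis
      then show False using a branch_rep(4)[OF that(2)] by simp
    qed
    ultimately show ?thesis using that by (auto simp: f_def \<Phi>_def coeff_sum_diff)
  qed
  have "inj_on f branches \<and> fun_space.independent (f ` branches)"
    by (rule independent_diagonal[where g = "\<lambda>K. K"]) (auto simp: unit)
  moreover have "f ` branches \<subseteq> fun_space.span (\<Phi> ` S)"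
    using \<open>toric \<subseteq> J\<close> branch_rep(3,5,6) single_diff_in_toric by (fastforce simp: f_def J_def)
  ultimately have "finite (f ` branches) \<and> card (f ` branches) \<le> card (\<Phi> ` S)" "inj_on f branches"
    using fun_space.independent_span_bound[of "\<Phi> ` S" "f ` branches"] S by auto
  then show ?thesis using card_image_le[OF S, of \<Phi>] by (auto simp: card_image finite_image_iff)
qed

subsection \<open>Relation vectors\<close>

definition vec :: "('x \<Rightarrow>\<^sub>0 nat) \<Rightarrow> ('x \<Rightarrow> real)" where
  "vec m = (\<lambda>e. real (lookup m e))"

text \<open>The part supported in \<open>W\<close> of the kernel of the degree matrix.\<close>

definition relations :: "'y set \<Rightarrow> ('x \<Rightarrow> real) set" where
  "relations W = {z. (\<forall>e. z e \<noteq> 0 \<longrightarrow> e \<in> E \<and> keys (d e) \<subseteq> W) \<and>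
                     (\<forall>v. (\<Sum>e\<in>E. z e * real (lookup (d e) v)) = 0)}"

lemma vec_add: "vec (m + m') = vec m + vec m'"
  by (auto simp: vec_def lookup_add)

lemma sum_vec:
  assumes "m \<in> monomials E"
  shows "(\<Sum>e\<in>E. vec m e * real (lookup (d e) v)) = real (lookup (deg m) v)"
  using assms by (simp add: lookup_deg_superset[OF finite_E] monomials_def vec_def)

lemma keys_d_subset: "e \<in> keys m \<Longrightarrow> keys (d e) \<subseteq> keys (deg m)"
  by (elim monomial_split) (auto simp: keys_deg_add)

lemma vec_diff_relation:
  assumes "u \<in> monomials E" "v \<in> monomials E" "deg u = deg v" "keys (deg u) \<subseteq> W"
  shows "vec u - vec v \<in> relations W"
proof -
  have "e \<in> E \<and> keys (d e) \<subseteq> W" if "(vec u - vec v) e \<noteq> 0" for e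
  proof -
    have "e \<in> keys u \<or> e \<in> keys v" using that by (auto simp: vec_def in_keys_iff)
    then show ?thesis using assms keys_d_subset[of e] unfolding monomials_def
      by (metis mem_Collect_eq order_trans subsetD)
  qed
  then show ?thesis using assms sum_vec[OF assms(1)] sum_vec[OF assms(2)]
    unfolding relations_def by (simp add: left_diff_distrib sum_subtractf)
qed

definition branch_vec :: "('x \<Rightarrow>\<^sub>0 nat) set \<Rightarrow> ('x \<Rightarrow> real)" where
  "branch_vec K = vec (rep K) - vec (root (deg (rep K)))"

lemma branch_vec_relation:
  assumes "K \<in> branches" "keys (deg (rep K)) \<subseteq> W"
  shows "branch_vec K \<in> relations W"
  unfolding branch_vec_def using branch_rep[OF assms(1)] assms(2)
  by (intro vec_diff_relation) auto

definition size_deg :: "('x \<Rightarrow>\<^sub>0 nat) \<Rightarrow> nat" where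
  "size_deg u = (\<Sum>v\<in>keys (deg u). lookup (deg u) v)"

lemma size_deg_less:
  assumes "e \<in> E"
  shows "size_deg m < size_deg (single e 1 + m)"
proof -
  let ?F = "keys (deg (single e 1 + m))"
  obtain w where w: "w \<in> keys (d e)" using d_nonzero[OF assms] by fastforce
  have "size_deg m = (\<Sum>v\<in>?F. lookup (deg m) v)"
    unfolding size_deg_def
    by (intro sum.mono_neutral_left) (auto simp: keys_deg_add not_in_keys_iff_lookup_eq_zero)
  also have "\<dots> < (\<Sum>v\<in>?F. lookup (deg (single e 1 + m)) v)"
  proof (rule sum_strict_mono_ex1)
    show "\<exists>v\<in>?F. lookup (deg m) v < lookup (deg (single e 1 + m)) v"
      using w by (intro bexI[of _ w]) (auto simp: deg_add lookup_add in_keys_iff)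
  qed (auto simp: deg_add lookup_add)
  finally show ?thesis by (simp add: size_deg_def)
qed

text \<open>Along a chain of linked monomials, a common variable can be cancelled from each step, which leaves a
  difference of smaller degree and no larger support; what remains are jumps to the root component.\<close>

lemma vec_diff_in_span:
  assumes "u \<in> monomials E" "v \<in> monomials E" "deg u = deg v" "keys (deg u) \<subseteq> W"
  shows "vec u - vec v \<in> fun_space.span (branch_vec ` branches \<inter> relations W)"
  using assms
proof (induction "size_deg u" arbitrary: u v rule: less_induct)
  case less
  let ?B = "branch_vec ` branches \<inter> relations W"
  have along_component: "vec u' - vec w \<in> fun_space.span ?B"
    if "(u', w) \<in> linked" and u': "deg u' = deg u" for u' w
    using that(1) unfolding linked_def
  proof (induction rule: rtrancl_induct)
    case base then show ?case by (simp add: fun_space.span_zero zero_fun_def[symmetric])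
  next
    case (step y z)
    then have "(u', y) \<in> linked" by (simp add: linked_def)
    then have deg_y: "deg y = deg u" using linked_deg(1) u' by metis
    have yz: "y \<in> monomials E" "z \<in> monomials E" "deg y = deg z" using step(2) by auto
    obtain e where e: "e \<in> keys y" "e \<in> keys z" using step(2) by auto
    obtain y' where y': "y = single e 1 + y'" using e(1) by (rule monomial_split)
    obtain z' where z': "z = single e 1 + z'" using e(2) by (rule monomial_split)
    have "e \<in> E" using e(1) yz(1) by (auto simp: monomials_def)
    then have "size_deg y' < size_deg u" using size_deg_less[of e y'] deg_y unfolding y' size_deg_def by simp
    moreover have "y' \<in> monomials E" "z' \<in> monomials E" "deg y' = deg z'"
      using yz unfolding y' z' monomials_add deg_add by auto
    moreover have "keys (deg y') \<subseteq> W"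
      using less.prems(4) unfolding deg_y[symmetric] y' keys_deg_add by simp
    ultimately have "vec y' - vec z' \<in> fun_space.span ?B" using less.hyps by blast
    moreover have "vec u' - vec z = (vec u' - vec y) + (vec y' - vec z')"
      by (simp add: y' z' vec_add)
    ultimately show ?case using step.IH fun_space.span_add by metis
  qed
  have to_root: "vec w - vec (root (deg u)) \<in> fun_space.span ?B"
    if w: "w \<in> monomials E" "deg w = deg u" for w
  proof (cases "root (deg u) \<in> component w")
    case True
    then show ?thesis using along_component w by (simp add: component_def)
  next
    case False
    then have K: "component w \<in> branches" using w by (auto simp: branches_def)
    let ?c = "rep (component w)"
    have link: "(w, ?c) \<in> linked" using branch_rep(2)[OF K] by (simp add: component_def)
    then have "deg ?c = deg u" using linked_deg(1) w(2) by metis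
    then have "branch_vec (component w) = vec ?c - vec (root (deg u))" "branch_vec (component w) \<in> ?B"
      using branch_vec_relation[OF K, of W] K less.prems(4) by (simp add: branch_vec_def, simp)
    then have "vec ?c - vec (root (deg u)) \<in> ?B" by simp
    from fun_space.span_add[OF along_component[OF link w(2)] fun_space.span_base[OF this]] show ?thesis by simp
  qed
  have "(vec u - vec (root (deg u))) - (vec v - vec (root (deg u))) \<in> fun_space.span ?B"
    using less.prems by (intro fun_space.span_diff[OF to_root to_root]) auto
  then show ?case by simp
qed

subsection \<open>Complete intersections have a basis of relation vectors\<close>

lemma power_product_Var:
  "length ts = length as \<Longrightarrow>
   power_product (map Var ts) as = (single (\<Sum>i<length ts. single (ts ! i) (as ! i)) 1 :: ('x, 'k::field) mpoly)"
proof (induction ts as rule: list_induct2)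
  case Nil then show ?case by simp
next
  case (Cons t ts a as)
  have "(Var t :: ('x, 'k) mpoly) ^ n = single (single t n) 1" for n
    by (induction n) (auto simp: Var_def mult_single single_add[symmetric])
  then show ?case using Cons by (simp add: mult_single sum.lessThan_Suc_shift del: sum.lessThan_Suc)
qed

text \<open>Distinct monomials in these variables have distinct degrees, so each coefficient of a relation
  is itself a coefficient sum over a fibre.\<close>

lemma alg_independent_Var:
  assumes inj: "inj_on deg (monomials T)" and ts: "distinct ts" "set ts = T"
  shows "alg_independent (toric :: ('x, 'k::field) mpoly set) (map Var ts)"
  unfolding alg_independent_def
proof (intro allI impI ballI)
  fix D and c :: "nat list \<Rightarrow> 'k" and as
  assume mem: "poly_in D c (map Var ts) \<in> toric" and "as \<in> exponents D (length (map (Var :: 'x \<Rightarrow> ('x, 'k) mpoly) ts))"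
  then have as: "as \<in> exponents D (length ts)" by simp
  define M where "M as = (\<Sum>i<length ts. single (ts ! i) (as ! i))" for as :: "nat list"
  have M_lookup: "lookup (M bs) (ts ! j) = bs ! j" if "j < length ts" for bs j
  proof -
    have "lookup (M bs) (ts ! j) = (\<Sum>i<length ts. if i = j then bs ! i else 0)"
      unfolding M_def lookup_sum using ts(1) that
      by (intro sum.cong) (auto simp: lookup_single when_def nth_eq_iff_index_eq)
    then show ?thesis using that by simp
  qed
  have M_mono: "M bs \<in> monomials T" for bs
    unfolding monomials_def M_def using ts(2) keys_sum[of _ "{..<length ts}"]
    by (fastforce simp: in_keys_iff lookup_sum lookup_single when_def split: if_splits)
  have M_deg: "deg (M bs) = deg (M as) \<longleftrightarrow> bs = as" if "bs \<in> exponents D (length ts)" for bs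
  proof
    assume "deg (M bs) = deg (M as)"
    then have "M bs = M as" using inj M_mono by (auto dest: inj_onD)
    then show "bs = as" using that as M_lookup by (intro nth_equalityI) (auto simp: exponents_def, metis)
  qed simp
  have "poly_in D c (map Var ts) = (\<Sum>bs\<in>exponents D (length ts). single (M bs) (c bs))"
    unfolding poly_in_def by (auto simp: power_product_Var exponents_def M_def Const_mult_single intro!: sum.cong)
  then have "coeff_sum {m. deg m = deg (M as)} (poly_in D c (map Var ts))
      = (\<Sum>bs\<in>exponents D (length ts). if bs = as then c bs else 0)"
    using M_deg by (auto simp: coeff_sum_sum intro!: sum.cong)
  also have "\<dots> = c as" using as by simp
  finally show "c as = 0" using mem by (simp add: toric_def)
qed

text \<open>By maximality of \<open>T\<close>, each variable outside \<open>T\<close> occurs in a relation whose other variables all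
  come from \<open>T\<close>; these relations form a diagonal matrix on the complement of \<open>T\<close>.\<close>

lemma independent_relations_of_card:
  assumes T: "T \<subseteq> E" and inj: "inj_on deg (monomials T)"
    and max: "\<And>e. e \<in> E - T \<Longrightarrow> \<not> inj_on deg (monomials (insert e T))"
  shows "\<exists>A. finite A \<and> card A = card (E - T) \<and> fun_space.independent A \<and>
    A \<subseteq> {vec u - vec v | u v. u \<in> monomials E \<and> v \<in> monomials E \<and> deg u = deg v}"
proof -
  have "\<exists>u v. u \<in> monomials (insert e T) \<and> v \<in> monomials (insert e T) \<and> deg u = deg v \<and> lookup u e \<noteq> lookup v e"
    if e: "e \<in> E - T" for e
  proof (rule ccontr)
    assume no: "\<not> ?thesis"
    obtain u v where uv: "u \<in> monomials (insert e T)" "v \<in> monomials (insert e T)" "deg u = deg v" "u \<noteq> v"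
      using max[OF e] by (auto simp: inj_on_def)
    have eq: "lookup u e = lookup v e" using no uv by blast
    \<comment> \<open>If \<open>e\<close> occurred equally often in both, cancelling it would give a coincidence of degrees on \<open>T\<close>.\<close>
    define s where "s = single e (lookup u e)"
    have split: "u = s + (u - s)" "v = s + (v - s)"
      using eq by (auto intro!: poly_mapping_eqI simp: s_def lookup_add lookup_minus lookup_single when_def)
    have "u - s \<in> monomials T" "v - s \<in> monomials T"
      using uv eq by (auto simp: monomials_def s_def subset_iff in_keys_iff lookup_minus lookup_single when_def split: if_splits)
    moreover have "deg (u - s) = deg (v - s)"
      using uv(3) split deg_add by (metis add_left_cancel)
    ultimately show False using inj uv(4) split by (metis inj_onD)
  qed
  then obtain u v where uv: "\<And>e. e \<in> E - T \<Longrightarrow> u e \<in> monomials (insert e T) \<and> v e \<in> monomials (insert e T) \<and>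
      deg (u e) = deg (v e) \<and> lookup (u e) e \<noteq> lookup (v e) e"
    by metis
  define f where "f e = vec (u e) - vec (v e)" for e
  have "inj_on f (E - T) \<and> fun_space.independent (f ` (E - T))"
  proof (rule independent_diagonal[where g = "\<lambda>e. e"])
    fix e e' assume e: "e \<in> E - T" "e' \<in> E - T" "e \<noteq> e'"
    then have "e' \<notin> keys (u e)" "e' \<notin> keys (v e)" using uv[OF e(1)] by (auto simp: monomials_def)
    then show "f e e' = 0" by (simp add: f_def vec_def not_in_keys_iff_lookup_eq_zero)
  next
    fix e assume "e \<in> E - T"
    then show "f e e \<noteq> 0" using uv by (simp add: f_def vec_def)
  qed
  moreover have "f ` (E - T) \<subseteq> {vec u - vec v | u v. u \<in> monomials E \<and> v \<in> monomials E \<and> deg u = deg v}"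
  proof (rule image_subsetI)
    fix e assume e: "e \<in> E - T"
    then have "u e \<in> monomials E" "v e \<in> monomials E" using uv[OF e] T by (auto simp: monomials_def)
    then show "f e \<in> {vec u - vec v | u v. u \<in> monomials E \<and> v \<in> monomials E \<and> deg u = deg v}"
      using uv[OF e] unfolding f_def by blast
  qed
  ultimately show ?thesis using finite_E by (intro exI[of _ "f ` (E - T)"]) (auto simp: card_image)
qed

text \<open>The family of branch vectors has at most as many members as the ideal needs generators, hence at
  most \<open>height \<le> card (E - T)\<close>, and it spans \<open>card (E - T)\<close> independent vectors; so it is itself independent.\<close>

lemma relation_basis:
  assumes ci: "min_generators (polynomial_ring E) (toric :: ('x, 'k::field) mpoly set)
                 \<le> height (polynomial_ring E) (toric :: ('x, 'k) mpoly set)"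
  shows "\<exists>B. fun_space.independent B \<and>
    (\<forall>W u v. u \<in> monomials E \<longrightarrow> v \<in> monomials E \<longrightarrow> deg u = deg v \<longrightarrow> keys (deg u) \<subseteq> W \<longrightarrow>
       vec u - vec v \<in> fun_space.span (B \<inter> relations W))"
proof -
  define \<T> where "\<T> = {T. T \<subseteq> E \<and> inj_on deg (monomials T)}"
  have "finite \<T>" using finite_E by (simp add: \<T>_def)
  moreover have "{} \<in> \<T>" by (auto simp: \<T>_def monomials_def)
  ultimately obtain T where T: "T \<in> \<T>" and max: "\<And>T'. T' \<in> \<T> \<Longrightarrow> T \<subseteq> T' \<Longrightarrow> T = T'"
    using finite_has_maximal[of \<T>] by blast
  have T_props: "T \<subseteq> E" "inj_on deg (monomials T)" "finite T"
    using T finite_E finite_subset by (auto simp: \<T>_def)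
  obtain ts where ts: "distinct ts" "set ts = T" using finite_distinct_list[OF T_props(3)] by blast
  have "set (map Var ts) \<subseteq> (polys E :: ('x, 'k) mpoly set)"
    using ts T_props(1) by (auto simp: Var_def polys_iff)
  from height_le[OF finite_E this alg_independent_Var[OF T_props(2) ts]]
  have height: "height (polynomial_ring E) (toric :: ('x, 'k) mpoly set) \<le> enat (card (E - T))"
    using distinct_card[OF ts(1)] ts(2) T_props finite_E by (simp add: card_Diff_subset)
  let ?G = "{enat (card S) | S :: ('x, 'k) mpoly set.
              finite S \<and> S \<subseteq> polys E \<and> genideal (polynomial_ring E) S = toric}"
  have le: "Inf ?G \<le> enat (card (E - T))" using ci height by (simp add: min_generators_def)
  then have "?G \<noteq> {}" by (auto simp: Inf_enat_def simp del: ex_simps split: if_splits)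
  then have "Inf ?G \<in> ?G" unfolding Inf_enat_def by (metis (no_types, lifting) LeastI_ex ex_in_conv)
  then obtain S :: "('x, 'k) mpoly set" where S: "finite S" "S \<subseteq> polys E"
      "genideal (polynomial_ring E) S = toric" "card S \<le> card (E - T)"
    using le by auto
  have branches: "finite branches" "card branches \<le> card (E - T)"
    using card_branches_le[OF S(1,3,2)] S(4) by auto
  have not_inj: "\<not> inj_on deg (monomials (insert e T))" if "e \<in> E - T" for e
    using max[of "insert e T"] that T_props(1) by (auto simp: \<T>_def)
  obtain A where A: "finite A" "card A = card (E - T)" "fun_space.independent A"
      "A \<subseteq> {vec u - vec v | u v. u \<in> monomials E \<and> v \<in> monomials E \<and> deg u = deg v}"
    using independent_relations_of_card[OF T_props(1,2) not_inj] by blast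
  have "A \<subseteq> fun_space.span (branch_vec ` branches)"
  proof
    fix z assume "z \<in> A"
    then obtain u v where uv: "z = vec u - vec v" "u \<in> monomials E" "v \<in> monomials E" "deg u = deg v"
      using A(4) by blast
    have "z \<in> fun_space.span (branch_vec ` branches \<inter> relations UNIV)"
      unfolding uv(1) by (rule vec_diff_in_span[OF uv(2-4)]) simp
    then show "z \<in> fun_space.span (branch_vec ` branches)" using fun_space.span_mono[of _ "branch_vec ` branches"] by blast
  qed
  then have "fun_space.independent (branch_vec ` branches)"
    using fun_space.independent_family_of_minimal_size[OF branches(1) A(3,1)] branches(2) A(2) by simp
  then show ?thesis
    by (intro exI[of _ "branch_vec ` branches"] conjI allI impI vec_diff_in_span)
qed

text \<open>The coefficients in the basis are unique, so a basis vector occurring in the first relation also occurs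
  in one of the other two, and is then supported in the vertex sets of both relations.\<close>

lemma relation_difference_decomposition:
  assumes ci: "min_generators (polynomial_ring E) (toric :: ('x, 'k::field) mpoly set)
                 \<le> height (polynomial_ring E) (toric :: ('x, 'k) mpoly set)"
    and mon: "\<And>i. i < 3 \<Longrightarrow> u i \<in> monomials E \<and> v i \<in> monomials E \<and> deg (u i) = deg (v i)"
    and supp: "\<And>i. i < (3::nat) \<Longrightarrow> keys (deg (u i)) \<subseteq> W i"
    and sum: "vec (u 0) - vec (v 0) = (vec (u 1) - vec (v 1)) - (vec (u 2) - vec (v 2))"
  shows "vec (u 0) - vec (v 0) \<in> fun_space.span (relations (W 0 \<inter> W 1) \<union> relations (W 0 \<inter> W 2))"
proof -
  obtain B where B: "fun_space.independent B"
    and span: "\<And>W u v. u \<in> monomials E \<Longrightarrow> v \<in> monomials E \<Longrightarrow> deg u = deg v \<Longrightarrow> keys (deg u) \<subseteq> W \<Longrightarrow>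
       vec u - vec v \<in> fun_space.span (B \<inter> relations W)"
    using relation_basis[OF ci] by blast
  have z: "vec (u i) - vec (v i) \<in> fun_space.span (B \<inter> relations (W i))" if "i < 3" for i
    using span mon[OF that] supp[OF that] by blast
  have "vec (u 1) - vec (v 1) \<in> fun_space.span (B \<inter> relations (W 1) \<union> B \<inter> relations (W 2))"
    "vec (u 2) - vec (v 2) \<in> fun_space.span (B \<inter> relations (W 1) \<union> B \<inter> relations (W 2))"
    using z[of 1] z[of 2] fun_space.span_mono[of "B \<inter> relations (W _)"] by (auto, (meson Un_upper1 Un_upper2 fun_space.span_mono subsetD)+)
  then have "vec (u 0) - vec (v 0) \<in> fun_space.span (B \<inter> relations (W 1) \<union> B \<inter> relations (W 2))"
    unfolding sum by (rule fun_space.span_diff)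
  from fun_space.span_Int_of_independent[OF B _ z[of 0] _ this]
  have "vec (u 0) - vec (v 0) \<in> fun_space.span (B \<inter> relations (W 0) \<inter> (B \<inter> relations (W 1) \<union> B \<inter> relations (W 2)))"
    by auto
  moreover have "B \<inter> relations (W 0) \<inter> (B \<inter> relations (W 1) \<union> B \<inter> relations (W 2))
      \<subseteq> relations (W 0 \<inter> W 1) \<union> relations (W 0 \<inter> W 2)"
    by (auto simp: relations_def)
  ultimately show ?thesis using fun_space.span_mono by blast
qed

end

section \<open>Toric ideals of graphs\<close>

definition incidence :: "'v set \<Rightarrow> ('v \<Rightarrow>\<^sub>0 nat)" where
  "incidence e = (\<Sum>v\<in>e. single v 1)"

lemma lookup_incidence: "finite e \<Longrightarrow> lookup (incidence e) v = (if v \<in> e then 1 else 0)"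
  by (simp add: incidence_def lookup_sum lookup_single when_def)

lemma keys_incidence: "finite e \<Longrightarrow> keys (incidence e) = e"
  by (auto simp: in_keys_iff lookup_incidence split: if_splits)

lemma edge_monomial_eq: "edge_monomial e = single (incidence e) 1"
  unfolding edge_monomial_def incidence_def
  by (induction e rule: infinite_finite_induct) (auto simp: Var_def mult_single)

lemma finite_edge: "simple_graph V E \<Longrightarrow> e \<in> E \<Longrightarrow> finite e"
  by (auto simp: simple_graph_def intro: finite_subset)

lemma monomial_map_incidence:
  assumes "simple_graph V E" shows "monomial_map E incidence"
proof
  show "finite E" using assms
    by (meson finite_Pow_iff finite_subset PowI simple_graph_def subsetI)
  show "incidence e \<noteq> 0" if "e \<in> E" for e
  proof -
    have "finite e" "e \<noteq> {}" using finite_edge[OF assms that] assms that by (auto simp: simple_graph_def)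
    then show ?thesis using keys_incidence[of e] by auto
  qed
qed

text \<open>The coefficient of a monomial in the image of \<open>p\<close> is the sum of the coefficients of \<open>p\<close> over its fibre.\<close>

lemma toric_ideal_eq:
  assumes "simple_graph V E"
  shows "(toric_ideal V E :: ('v set, 'k::field) mpoly set) = monomial_map.toric E incidence"
proof -
  interpret monomial_map E incidence by (rule monomial_map_incidence[OF assms])
  have power: "(single a (1::'k)) ^ n = single (\<Sum>i<n. a) 1" for a :: "'v \<Rightarrow>\<^sub>0 nat" and n
    by (induction n) (auto simp: mult_single add.commute)
  have prod: "(\<Prod>x\<in>F. single (f x) (1::'k)) = single (\<Sum>x\<in>F. f x) 1"
    for F :: "'v set set" and f :: "'v set \<Rightarrow> ('v \<Rightarrow>\<^sub>0 nat)"
    by (induction F rule: infinite_finite_induct) (auto simp: mult_single)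
  have subst: "subst edge_monomial p = (\<Sum>m\<in>keys p. single (deg m) (lookup p m))"
    for p :: "('v set, 'k) mpoly"
    unfolding subst_def edge_monomial_eq power prod Const_mult_single deg_def by simp
  have "lookup (subst edge_monomial p) \<beta> = coeff_sum {m. deg m = \<beta>} p"
    for p :: "('v set, 'k) mpoly" and \<beta>
    by (simp add: subst lookup_sum lookup_single when_def coeff_sum_superset[of "keys p"])
  then have "subst edge_monomial p = 0 \<longleftrightarrow> (\<forall>\<beta>. coeff_sum {m. deg m = \<beta>} p = 0)"
    for p :: "('v set, 'k) mpoly"
    by (simp add: poly_mapping_eq_iff fun_eq_iff)
  then show ?thesis by (simp add: toric_ideal_def a_kernel_def' toric_def)
qed

section \<open>Alternating edges along a path\<close>

text \<open>The product of the first, third, fifth, \<dots> edge of a path, as an exponent vector; the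
  remaining edges are those selected by \<open>alternating (tl p)\<close>.\<close>

fun alternating :: "'v list \<Rightarrow> ('v set \<Rightarrow>\<^sub>0 nat)" where
  "alternating (x # y # p) = single {x, y} 1 + alternating p"
| "alternating _ = 0"

definition path_edges :: "'v list \<Rightarrow> 'v set set" where
  "path_edges p = {{p ! i, p ! Suc i} | i. Suc i < length p}"

lemma path_edges_Cons: "path_edges p \<subseteq> path_edges (x # p)"
proof
  fix e assume "e \<in> path_edges p"
  then obtain i where "e = {p ! i, p ! Suc i}" "Suc i < length p" by (auto simp: path_edges_def)
  then show "e \<in> path_edges (x # p)"
    unfolding path_edges_def by (intro CollectI exI[of _ "Suc i"]) auto
qed

lemma keys_alternating: "keys (alternating p) \<subseteq> path_edges p"
proof (induction p rule: alternating.induct)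
  case (1 x y p)
  have "{x, y} \<in> path_edges (x # y # p)"
    unfolding path_edges_def by (rule CollectI, rule exI[of _ 0]) auto
  moreover have "path_edges p \<subseteq> path_edges (x # y # p)"
    using path_edges_Cons order_trans by metis
  moreover have "keys (alternating (x # y # p)) \<subseteq> insert {x, y} (keys (alternating p))"
    using Poly_Mapping.keys_add[of "single {x, y} (1::nat)" "alternating p"] by auto
  ultimately show ?case using 1 by (meson insert_subset order_trans)
qed auto

text \<open>The selected edges form a matching that covers every vertex, except the last one when the
  number of vertices is odd.\<close>

lemma deg_alternating:
  fixes E :: "'v set set" and p :: "'v list"
  assumes "monomial_map E incidence" and "distinct p"
  shows "monomial_map.deg incidence (alternating p) + (if odd (length p) then single (last p) 1 else 0)
     = (\<Sum>v\<in>set p. single v 1)"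
proof -
  interpret monomial_map E incidence by fact
  show ?thesis using assms(2)
    by (induction p rule: alternating.induct) (auto simp: deg_add incidence_def ac_simps dest!: sym[of _ "sum _ _"])
qed

lemma path_alternating:
  assumes G: "simple_graph V E" and p: "path_between V E x y p" and xy: "x \<noteq> y"
  defines "a \<equiv> alternating p" and "b \<equiv> alternating (tl p)"
  shows "keys a \<subseteq> {e \<in> E. e \<subseteq> set p}" "keys b \<subseteq> {e \<in> E. e \<subseteq> set p}"
    "even (path_length p) \<Longrightarrow>
       monomial_map.deg incidence a + single y 1 = monomial_map.deg incidence b + single x 1"
    "odd (path_length p) \<Longrightarrow>
       monomial_map.deg incidence a = monomial_map.deg incidence b + single x 1 + single y 1"
proof -
  note mm = monomial_map_incidence[OF G]
  obtain q where q: "p = x # q" "q \<noteq> []" "last q = y" "distinct q" "x \<notin> set q" "last p = y"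
    using p xy unfolding path_between_def by (cases p) (auto split: if_splits)
  have edges: "path_edges p \<subseteq> {e \<in> E. e \<subseteq> set p}"
    using p unfolding path_edges_def path_between_def by auto
  then show "keys a \<subseteq> {e \<in> E. e \<subseteq> set p}"
    using keys_alternating[of p] unfolding a_def by (rule order_trans[rotated])
  have "path_edges (tl p) \<subseteq> path_edges p" using path_edges_Cons[of q x] by (simp add: q(1))
  then show "keys b \<subseteq> {e \<in> E. e \<subseteq> set p}"
    using keys_alternating[of "tl p"] edges unfolding b_def by (meson order_trans)
  have len: "path_length p = length q" by (simp add: path_length_def q)
  have tlp: "tl p = q" by (simp add: q)
  have dist: "distinct p" using p by (simp add: path_between_def)
  have total: "(\<Sum>v\<in>set p. single v (1::nat)) = single x 1 + (\<Sum>v\<in>set q. single v 1)"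
    using q by simp
  note degs = deg_alternating[OF mm dist] deg_alternating[OF mm q(4)]
  show "monomial_map.deg incidence a + single y 1 = monomial_map.deg incidence b + single x 1"
    if "even (path_length p)"
    using degs that total q(6) unfolding len a_def b_def tlp by (simp add: q(1) add.commute)
  show "monomial_map.deg incidence a = monomial_map.deg incidence b + single x 1 + single y 1"
    if "odd (path_length p)"
  proof -
    have "(\<Sum>v\<in>set q. single v (1::nat)) = monomial_map.deg incidence b + single y 1"
      using degs(2) that q(3) unfolding len b_def tlp by simp
    moreover have "monomial_map.deg incidence a = (\<Sum>v\<in>set p. single v 1)"
      using degs(1) that unfolding len a_def by (simp add: q(1))
    ultimately show ?thesis unfolding total by (simp add: ac_simps)
  qed
qed

section \<open>Theta graphs\<close>

text \<open>Three vertex sets that pairwise meet in \<open>{x, y}\<close> only, with monomials \<open>a\<^sub>i\<close>, \<open>b\<^sub>i\<close> on each of them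
  that can be exchanged between any two.  A vertex weight \<open>\<omega>\<close> defines the functional \<open>\<psi>\<close> that adds up \<open>\<omega>\<close> over
  the edges inside the first set.  It vanishes on relations inside that set, and on vectors
  supported in the second set because the edge \<open>xy\<close>, if present, has weight \<open>0\<close>; so it separates
  \<open>a\<^sub>0 b\<^sub>1 - b\<^sub>0 a\<^sub>1\<close> from what the decomposition of relations permits.\<close>

lemma no_three_blocks_if_complete_intersection:
  fixes E :: "'v set set" and \<omega> :: "'v \<Rightarrow> real"
  assumes G: "simple_graph V E" and ci: "complete_intersection TYPE('k::field) V E"
    and supp: "\<And>i. i < 3 \<Longrightarrow> keys (a i) \<subseteq> {e \<in> E. e \<subseteq> P i} \<and> keys (b i) \<subseteq> {e \<in> E. e \<subseteq> P i}"
    and P: "\<And>i j. i < (3::nat) \<Longrightarrow> j < 3 \<Longrightarrow> i \<noteq> j \<Longrightarrow> P i \<inter> P j = {x, y}" and xy: "x \<noteq> y"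
    and deg: "\<And>i j. i < 3 \<Longrightarrow> j < 3 \<Longrightarrow>
      monomial_map.deg incidence (a i + b j) = monomial_map.deg incidence (b i + a j)"
    and \<omega>: "{x, y} \<in> E \<Longrightarrow> \<omega> x + \<omega> y = 0"
    and sep: "(\<Sum>v\<in>V. \<omega> v * real (lookup (monomial_map.deg incidence (a 0)) v))
       \<noteq> (\<Sum>v\<in>V. \<omega> v * real (lookup (monomial_map.deg incidence (b 0)) v))"
  shows False
proof -
  interpret monomial_map E incidence by (rule monomial_map_incidence[OF G])
  have V: "finite V" and EV: "\<And>e. e \<in> E \<Longrightarrow> e \<subseteq> V \<and> card e = 2" using G by (auto simp: simple_graph_def)
  have E_fin: "finite e" if "e \<in> E" for e using finite_edge[OF G that] .
  have ci': "min_generators (polynomial_ring E) (toric :: ('v set, 'k) mpoly set)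
      \<le> height (polynomial_ring E) (toric :: ('v set, 'k) mpoly set)"
    using ci unfolding complete_intersection_def Let_def toric_ideal_eq[OF G] by simp
  \<comment> \<open>The pairs \<open>(s i, t i)\<close> for \<open>i = 0, 1, 2\<close> are \<open>(0, 1)\<close>, \<open>(0, 2)\<close>, \<open>(1, 2)\<close>.\<close>
  define s t :: "nat \<Rightarrow> nat" where "s i = (if i = 2 then 1 else 0)" and "t i = (if i = 0 then 1 else 2)" for i
  define u where "u i = a (s i) + b (t i)" for i
  define v where "v i = b (s i) + a (t i)" for i
  have st: "s i < 3" "t i < 3" for i by (auto simp: s_def t_def)
  have mon: "a i \<in> monomials E" "b i \<in> monomials E" if "i < 3" for i
    using supp[OF that] by (auto simp: monomials_def)
  have keys_deg: "keys (deg m) \<subseteq> W" if "keys m \<subseteq> {e \<in> E. e \<subseteq> W}" for m W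
  proof
    fix w assume "w \<in> keys (deg m)"
    then have "lookup (deg m) w \<noteq> 0" by (simp add: in_keys_iff)
    then obtain e where "e \<in> keys m" "lookup (incidence e) w \<noteq> 0"
      using lookup_deg_superset[of "keys m" m w] by (auto dest: sum.not_neutral_contains_not_neutral)
    moreover from this have "e \<in> E" "e \<subseteq> W" using that by auto
    ultimately show "w \<in> W" using lookup_incidence[OF E_fin, of e w] by (auto split: if_splits)
  qed
  have "vec (u 0) - vec (v 0)
      \<in> fun_space.span (relations ((P (s 0) \<union> P (t 0)) \<inter> (P (s 1) \<union> P (t 1)))
                     \<union> relations ((P (s 0) \<union> P (t 0)) \<inter> (P (s 2) \<union> P (t 2))))"
  proof (rule relation_difference_decomposition[OF ci', where W = "\<lambda>i. P (s i) \<union> P (t i)"])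
    show "u i \<in> monomials E \<and> v i \<in> monomials E \<and> deg (u i) = deg (v i)" for i
      using mon st deg[OF st[of i]] by (simp add: u_def v_def monomials_add)
    show "keys (deg (u i)) \<subseteq> P (s i) \<union> P (t i)" for i
      using keys_deg[of "a (s i)" "P (s i)"] keys_deg[of "b (t i)" "P (t i)"] supp[OF st(1)[of i]] supp[OF st(2)[of i]]
      unfolding u_def keys_deg_add by blast
    show "vec (u 0) - vec (v 0) = (vec (u 1) - vec (v 1)) - (vec (u 2) - vec (v 2))"
      by (simp add: u_def v_def vec_add s_def t_def)
  qed
  also have "(P (s 0) \<union> P (t 0)) \<inter> (P (s 1) \<union> P (t 1)) = P 0"
    using P[of 0 1] P[of 0 2] P[of 1 2] by (auto simp: s_def t_def)
  also have "(P (s 0) \<union> P (t 0)) \<inter> (P (s 2) \<union> P (t 2)) = P 1"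
    using P[of 0 1] P[of 0 2] P[of 1 2] by (auto simp: s_def t_def)
  finally have span: "vec (u 0) - vec (v 0) \<in> fun_space.span (relations (P 0) \<union> relations (P 1))" .
  define \<psi> where "\<psi> z = (\<Sum>e\<in>{e \<in> E. e \<subseteq> P 0}. z e * (\<Sum>w\<in>e. \<omega> w))" for z :: "'v set \<Rightarrow> real"
  have \<psi>_add: "\<psi> (z + z') = \<psi> z + \<psi> z'" and \<psi>_diff: "\<psi> (z - z') = \<psi> z - \<psi> z'" for z z'
    by (simp_all add: \<psi>_def algebra_simps sum.distrib sum_subtractf)
  have \<psi>_all: "\<psi> z = (\<Sum>w\<in>V. \<omega> w * (\<Sum>e\<in>E. z e * real (lookup (incidence e) w)))"
    if z: "\<And>e. z e \<noteq> 0 \<Longrightarrow> e \<subseteq> P 0" for z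
  proof -
    have "\<psi> z = (\<Sum>e\<in>E. z e * (\<Sum>w\<in>e. \<omega> w))"
      unfolding \<psi>_def using finite_E z by (intro sum.mono_neutral_left) auto
    also have "\<dots> = (\<Sum>e\<in>E. z e * (\<Sum>w\<in>V. \<omega> w * real (lookup (incidence e) w)))"
    proof (rule sum.cong[OF refl])
      fix e assume e: "e \<in> E"
      have "(\<Sum>w\<in>V. \<omega> w * real (lookup (incidence e) w)) = (\<Sum>w\<in>e. \<omega> w * real (lookup (incidence e) w))"
        using V EV[OF e] E_fin[OF e] by (intro sum.mono_neutral_right) (auto simp: lookup_incidence)
      also have "\<dots> = (\<Sum>w\<in>e. \<omega> w)" using E_fin[OF e] by (simp add: lookup_incidence)
      finally show "z e * (\<Sum>w\<in>e. \<omega> w) = z e * (\<Sum>w\<in>V. \<omega> w * real (lookup (incidence e) w))" by simp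
    qed
    also have "\<dots> = (\<Sum>w\<in>V. \<omega> w * (\<Sum>e\<in>E. z e * real (lookup (incidence e) w)))"
      by (subst sum_distrib_left, subst sum.swap) (simp add: sum_distrib_left ac_simps)
    finally show ?thesis .
  qed
  have \<psi>_crossing: "\<psi> z = 0" if z: "\<And>e. z e \<noteq> 0 \<Longrightarrow> e \<subseteq> P 1" for z
    unfolding \<psi>_def
  proof (rule sum.neutral, rule ballI)
    fix e assume e: "e \<in> {e \<in> E. e \<subseteq> P 0}"
    show "z e * (\<Sum>w\<in>e. \<omega> w) = 0"
    proof (cases "z e = 0")
      case False
      then have "e \<subseteq> {x, y}" using z e P[of 0 1] by auto
      moreover have "card e = card {x, y}" using EV e xy by simp
      ultimately have "e = {x, y}" by (metis card_subset_eq finite.emptyI finite.insertI)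
      then show ?thesis using \<omega> e xy by simp
    qed simp
  qed
  have rel_supp: "e \<subseteq> W" if "r \<in> relations W" "r e \<noteq> 0" for r W e
  proof -
    have "e \<in> E" "keys (incidence e) \<subseteq> W" using that by (auto simp: relations_def)
    then show ?thesis using keys_incidence[OF E_fin, of e] by simp
  qed
  have \<psi>_span: "\<psi> z = 0" if "z \<in> fun_space.span (relations (P 0) \<union> relations (P 1))" for z
    using that
  proof (induction rule: fun_space.span_induct_alt)
    case base show ?case by (simp add: \<psi>_def)
  next
    case (step c r z)
    have "\<psi> r = 0"
      using step(1)
    proof
      assume r: "r \<in> relations (P 0)"
      then have "\<psi> r = (\<Sum>w\<in>V. \<omega> w * (\<Sum>e\<in>E. r e * real (lookup (incidence e) w)))"
        using rel_supp by (intro \<psi>_all)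
      then show ?thesis using r by (simp add: relations_def)
    next
      assume "r \<in> relations (P 1)"
      then show ?thesis using rel_supp by (intro \<psi>_crossing)
    qed
    moreover have "\<psi> (\<lambda>e. c * r e) = c * \<psi> r" by (simp add: \<psi>_def sum_distrib_left ac_simps)
    ultimately show ?case using step.IH unfolding \<psi>_add by simp
  qed
  have \<psi>_monomial: "\<psi> (vec m) = (\<Sum>v\<in>V. \<omega> v * real (lookup (deg m) v))"
    if m: "keys m \<subseteq> {e \<in> E. e \<subseteq> P 0}" for m
  proof -
    have "e \<subseteq> P 0" if "vec m e \<noteq> 0" for e
      using m that by (auto simp: vec_def in_keys_iff subset_iff)
    moreover have "m \<in> monomials E" using m by (auto simp: monomials_def)
    ultimately show ?thesis by (simp add: \<psi>_all sum_vec)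
  qed
  have "\<psi> (vec (u 0) - vec (v 0)) = 0" by (rule \<psi>_span[OF span])
  moreover have "\<psi> (vec (a 1)) = 0" "\<psi> (vec (b 1)) = 0"
    using supp[of 1] by (auto intro!: \<psi>_crossing simp: vec_def in_keys_iff subset_iff)
  moreover have "\<psi> (vec (a 0)) = (\<Sum>v\<in>V. \<omega> v * real (lookup (deg (a 0)) v))"
    "\<psi> (vec (b 0)) = (\<Sum>v\<in>V. \<omega> v * real (lookup (deg (b 0)) v))"
    using \<psi>_monomial supp[of 0] by auto
  ultimately show False using sep by (simp add: u_def v_def s_def t_def vec_add \<psi>_add \<psi>_diff)
qed

theorem theorem5p7:
  shows "(\<forall>(V :: 'v set) E x y. odd_theta_graph V E x y \<and> {x, y} \<notin> E \<longrightarrow>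
            \<not> complete_intersection TYPE('k::field) V E) \<and>
         (\<forall>(V :: 'v set) E x y. even_theta_graph V E x y \<longrightarrow>
            \<not> complete_intersection TYPE('k::field) V E)"
proof -
  have main: False
    if theta: "theta_paths V E x y p1 p2 p3" and ci: "complete_intersection TYPE('k) V E"
      and parity: "(\<forall>p\<in>{p1, p2, p3}. even (path_length p)) \<or>
        {x, y} \<notin> E \<and> (\<forall>p\<in>{p1, p2, p3}. odd (path_length p))"
    for V :: "'v set" and E x y p1 p2 p3
  proof -
    have G: "simple_graph V E" and xy: "x \<noteq> y" and paths: "\<forall>p\<in>{p1, p2, p3}. path_between V E x y p"
      and meet: "set p1 \<inter> set p2 = {x, y}" "set p1 \<inter> set p3 = {x, y}" "set p2 \<inter> set p3 = {x, y}"
      and V: "V = set p1 \<union> set p2 \<union> set p3"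
      using theta by (auto simp: theta_paths_def)
    interpret monomial_map E incidence by (rule monomial_map_incidence[OF G])
    define p where "p i = [p1, p2, p3] ! i" for i
    have p: "p i \<in> {p1, p2, p3}" if "i < 3" for i
      using that by (auto simp: p_def less_Suc_eq numeral_3_eq_3)
    then have path: "path_between V E x y (p i)" if "i < 3" for i using paths that by blast
    define a b where "a i = alternating (p i)" and "b i = alternating (tl (p i))" for i
    note alt = path_alternating[OF G path xy, folded a_def b_def]
    define even_case where "even_case \<longleftrightarrow> (\<forall>p\<in>{p1, p2, p3}. even (path_length p))"
    \<comment> \<open>The weight must vanish on \<open>xy\<close> if that is an edge, but not on the degree of \<open>a\<^sub>0 - b\<^sub>0\<close>, which is \<open>x - y\<close>
      in the even and \<open>x + y\<close> in the odd case.\<close>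
    define \<omega> :: "'v \<Rightarrow> real" where
      "\<omega> v = (if v = x then 1 else if v = y \<and> even_case then - 1 else 0)" for v
    have deg_even: "deg (a i) + single y 1 = deg (b i) + single x 1" if "even_case" "i < 3" for i
      using alt(3)[OF that(2)] that p even_case_def by blast
    have deg_odd: "deg (a i) = deg (b i) + single x 1 + single y 1" if "\<not> even_case" "i < 3" for i
      using alt(4)[OF that(2)] that p parity even_case_def by blast
    have xyV: "x \<in> V" "y \<in> V" "finite V" using V meet by auto
    have \<omega>_sum: "(\<Sum>v\<in>V. \<omega> v * real (lookup m v)) = real (lookup m x) - (if even_case then real (lookup m y) else 0)" for m
    proof -
      have "(\<Sum>v\<in>V. \<omega> v * real (lookup m v)) = (\<Sum>v\<in>{x, y}. \<omega> v * real (lookup m v))"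
        using xyV by (intro sum.mono_neutral_right) (auto simp: \<omega>_def)
      then show ?thesis using xy by (simp add: \<omega>_def)
    qed
    show False
    proof (rule no_three_blocks_if_complete_intersection[OF G ci, where a = a and b = b and P = "\<lambda>i. set (p i)" and \<omega> = \<omega>])
      show "keys (a i) \<subseteq> {e \<in> E. e \<subseteq> set (p i)} \<and> keys (b i) \<subseteq> {e \<in> E. e \<subseteq> set (p i)}" if "i < 3" for i
        using alt(1,2)[OF that] by simp
      show "set (p i) \<inter> set (p j) = {x, y}" if "i < 3" "j < 3" "i \<noteq> j" for i j
      proof -
        have "i \<in> {0, 1, 2}" "j \<in> {0, 1, 2}" using that by auto
        then show ?thesis using that(3) meet by (elim insertE emptyE) (simp_all add: p_def Int_commute)
      qed
      show "x \<noteq> y" by (rule xy)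
      show "deg (a i + b j) = deg (b i + a j)" if "i < 3" "j < 3" for i j
      proof (cases even_case)
        case True
        have "deg (a i + b j) + (single y 1 + single x 1) = (deg (a i) + single y 1) + (deg (b j) + single x 1)"
          by (simp add: deg_add ac_simps)
        also have "\<dots> = (deg (b i) + single x 1) + (deg (a j) + single y 1)"
          using deg_even[OF True] that by simp
        also have "\<dots> = deg (b i + a j) + (single y 1 + single x 1)"
          by (simp add: deg_add ac_simps)
        finally show ?thesis by simp
      next
        case False
        then show ?thesis using deg_odd[OF False] that by (simp add: deg_add ac_simps)
      qed
      show "\<omega> x + \<omega> y = 0" if "{x, y} \<in> E"
        using that parity xy by (auto simp: \<omega>_def even_case_def)
      show "(\<Sum>v\<in>V. \<omega> v * real (lookup (deg (a 0)) v)) \<noteq> (\<Sum>v\<in>V. \<omega> v * real (lookup (deg (b 0)) v))"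
      proof (cases even_case)
        case True
        have "lookup (deg (a 0)) x = lookup (deg (b 0)) x + 1" "lookup (deg (a 0)) y + 1 = lookup (deg (b 0)) y"
          using arg_cong[OF deg_even[OF True, of 0], of "\<lambda>m. lookup m x"]
            arg_cong[OF deg_even[OF True, of 0], of "\<lambda>m. lookup m y"] xy
          by (auto simp: lookup_add lookup_single when_def)
        then show ?thesis unfolding \<omega>_sum using True by simp
      next
        case False
        then show ?thesis unfolding \<omega>_sum using deg_odd[OF False, of 0] xy
          by (simp add: lookup_add lookup_single when_def)
      qed
    qed
  qed
  show ?thesis
    using main unfolding odd_theta_graph_def even_theta_graph_def by blast
qed

end
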